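(* Let $\Bbbk$ be a field, let $2 \le m < n$ be integers, and let $\Delta$, its set of facets $\mathfrak{F}(\Delta)$, the total order $<$ on $\mathfrak{F}(\Delta)$, and the subsets $F^+,F^-\subseteq F$ of a facet $F$ be as defined in the context. For every facet $F\in\mathfrak{F}(\Delta)$: (i) $\langle F\rangle\cap\langle G\in\mathfrak{F}(\Delta): G<F\rangle=\langle F\setminus\{v\}: v\in F^-\rangle$; (ii) $\langle F\rangle\cap\langle G\in\mathfrak{F}(\Delta): G>F\rangle=\langle F\setminus\{v\}: v\in F^+\rangle$. (Here in (i) both sides are empty if $F$ is the minimal facet, and in (ii) both sides are empty if $F$ is the maximal facet.) In particular, the order $<$ on the facets is a two-way shelling of $\Delta$.
   Context: Notation: $[k]=\{1,\dots,k\}$. $\langle F_1,\dots,F_s\rangle$ denotes the simplicial complex generated by the faces $F_1,\dots,F_s$ (all subsets of some $F_i$; it is empty if there are no generators). The complex $\Delta$: let $X=(x_{i,j})_{i\in[m],\,j\in[n]}$ be a matrix of variables, $S=\Bbbk[X]$, $I_2\subseteq S$ the ideal of $2$-minors of $X$. Let $\prec$ be the degree reverse lexicographic monomial order on $S$ induced by the order of the variables in which the off-diagonal variables are listed in decreasing order row by row (top to bottom) from left to right, followed by the main diagonal variables $x_{1,1}\succ\dots\succ x_{m,m}$ as the smallest ones. Let $I=\mathrm{in}_\prec(I_2)$, a square-free monomial ideal, with Stanley-Reisner complex $\Delta_I$ on $[m]\times[n]$ ($\sigma\in\Delta_I$ iff $\prod_{(i,j)\in\sigma}x_{i,j}\notin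 I$). The cone points of $\Delta_I$ are the $(k,k)$, $k\in[m]$; let $\Delta$ be the restriction of $\Delta_I$ to $V=([m]\times[n])\setminus\{(k,k):k\in[m]\}$. It is pure of dimension $n-2$. Facets: for a facet $F$ of $\Delta$ let $r^F\subseteq[m]$ and $c^F\subseteq[n]$ be the sets of rows and columns of the vertices of $F$. Then $c^F=[n]\setminus r^F$, $r^F\neq\emptyset$, and, in the submatrix $M^F$ of positions with rows in $r^F$ and columns in $c^F$, $F$ is a lattice path from the top-left entry to the bottom-right entry in which each vertex is one step lower or one step to the right (within $M^F$) with respect to the previous one. Types of vertices of $F$ (positions considered in $M^F$): a vertex is right turning if it has a previous vertex one step to the left and a following vertex one step lower; left turning if it has a previous vertex one step higher and a following vertex one step to the right; horizontal if it is the only vertex of $F$ in its column; vertical if it is the only vertex of $F$ in its row. Order on facets: for distinct nonempty $r_1=\{a_1<\dots<a_c\}$ and $r_2=\{b_1<\dots<b_d\}$ in $[m]$, put $r_1<r_2$ iff either $a_i<b_i$ for the smallest $i$ such that $a_i\neq b_i$, or $c<d$ and $a_i=b_i$ for all $i\in[c]$. For distinct facets $F,G$: $F<G$ iff either $r^F<r^G$, or $r^F=r^G$ and the first vertex in which the paths differ (starting from the top-left) is one step to the right of the previous vertex in $F$ and one step lower in $G$. This is a total order on $\mathfrak{F}(\Delta)$. For a facet $F$: $F^+=\{v\in F: v$ right turning$\}\cup\{v=(i,j)\in F: v$ horizontal, $\max(r^F)<j\le m\}\cup\{v=(i,j)\in F: v$ vertical, $i<\max(r^F)\}$; $F^-=\{v\in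 F: v$ left turning$\}\cup\{v=(i,j)\in F: v$ horizontal, $j<\max(r^F)\}\cup\{v=(i,j)\in F: v$ vertical, $i=\max(r^F)\}$. A total order $F_1,\dots,F_c$ on the facets of a pure $d$-dimensional simplicial complex is a shelling order if for all $i\in\{2,\dots,c\}$ the complex $\langle F_i\rangle\cap\langle F_1,\dots,F_{i-1}\rangle$ is pure of dimension $d-1$; it is a two-way shelling if also $F_c,\dots,F_1$ is a shelling order. *)

theory Defs
  imports "HOL-Library.Poly_Mapping" "HOL-Algebra.Ideal"
begin

section \<open>Polynomial rings\<close>

text \<open>
  A monomial is its exponent vector \<^typ>\<open>'v \<Rightarrow>\<^sub>0 nat\<close>, and a polynomial is the
  finitely supported function from monomials to coefficients. The type has a variable for every
  element of \<^typ>\<open>'v\<close>; \<open>poly_ring X\<close> is the polynomial ring in the variables from \<open>X\<close> only.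
\<close>

type_synonym ('v, 'k) mpoly = "('v \<Rightarrow>\<^sub>0 nat) \<Rightarrow>\<^sub>0 'k"

definition poly_ring :: "'v set \<Rightarrow> ('v, 'k::field) mpoly ring" where
  "poly_ring X =
     \<lparr>carrier = {p. \<forall>u\<in>Poly_Mapping.keys p. Poly_Mapping.keys u \<subseteq> X},
      mult = (*), one = 1, zero = 0, add = (+)\<rparr>"

definition term_poly :: "('v \<Rightarrow>\<^sub>0 nat) \<Rightarrow> ('v, 'k::field) mpoly" where
  "term_poly u = Poly_Mapping.single u 1"

definition var :: "'v \<Rightarrow> ('v, 'k::field) mpoly" where
  "var x = term_poly (Poly_Mapping.single x 1)"

text \<open>
  The following lemma ensures that \<^const>\<open>genideal\<close> (an intersection of all ideals above a set)
  has its intended meaning in \<^const>\<open>poly_ring\<close>.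
\<close>

lemma cring_poly_ring: "cring (poly_ring X :: ('v, 'k::field) mpoly ring)"
proof -
  have neg: "\<exists>q. (\<forall>u\<in>Poly_Mapping.keys q. Poly_Mapping.keys u \<subseteq> X) \<and> q + p = 0"
    if "\<forall>u\<in>Poly_Mapping.keys p. Poly_Mapping.keys u \<subseteq> X" for p :: "('v, 'k) mpoly"
    using that by (intro exI[of _ "- p"]) simp
  have add: "\<forall>u\<in>Poly_Mapping.keys (p + q). Poly_Mapping.keys u \<subseteq> X"
    if "\<forall>u\<in>Poly_Mapping.keys p. Poly_Mapping.keys u \<subseteq> X"
       "\<forall>u\<in>Poly_Mapping.keys q. Poly_Mapping.keys u \<subseteq> X" for p q :: "('v, 'k) mpoly"
    using that Poly_Mapping.keys_add[of p q] by blast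
  have mult: "\<forall>u\<in>Poly_Mapping.keys (p * q). Poly_Mapping.keys u \<subseteq> X"
    if p: "\<forall>u\<in>Poly_Mapping.keys p. Poly_Mapping.keys u \<subseteq> X"
      and q: "\<forall>u\<in>Poly_Mapping.keys q. Poly_Mapping.keys u \<subseteq> X" for p q :: "('v, 'k) mpoly"
  proof
    fix u assume "u \<in> Poly_Mapping.keys (p * q)"
    then obtain a b where "a \<in> Poly_Mapping.keys p" "b \<in> Poly_Mapping.keys q" "u = a + b"
      using Poly_Mapping.keys_mult[of p q] by blast
    with p q show "Poly_Mapping.keys u \<subseteq> X"
      using Poly_Mapping.keys_add[of a b] by blast
  qed
  let ?R = "poly_ring X :: ('v, 'k) mpoly ring"
  have "abelian_group ?R"
  proof (rule abelian_groupI)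
    fix p assume "p \<in> carrier ?R"
    then show "\<exists>q\<in>carrier ?R. q \<oplus>\<^bsub>?R\<^esub> p = \<zero>\<^bsub>?R\<^esub>"
      using neg[of p] by (simp add: poly_ring_def Bex_def)
  next
    fix p q assume "p \<in> carrier ?R" "q \<in> carrier ?R"
    then show "p \<oplus>\<^bsub>?R\<^esub> q \<in> carrier ?R"
      using add[of p q] by (simp add: poly_ring_def)
  qed (simp_all add: poly_ring_def ac_simps)
  moreover have "Group.comm_monoid ?R"
  proof (rule comm_monoidI)
    fix p q assume "p \<in> carrier ?R" "q \<in> carrier ?R"
    then show "p \<otimes>\<^bsub>?R\<^esub> q \<in> carrier ?R"
      using mult[of p q] by (simp add: poly_ring_def)
  qed (simp_all add: poly_ring_def ac_simps)
  ultimately show ?thesis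
    by (rule cringI) (simp add: poly_ring_def distrib_right)
qed


section \<open>Monomial orders and initial ideals\<close>

definition mono_deg :: "('v \<Rightarrow>\<^sub>0 nat) \<Rightarrow> nat" where
  "mono_deg u = (\<Sum>x\<in>Poly_Mapping.keys u. Poly_Mapping.lookup u x)"

text \<open>
  Degree reverse lexicographic order, where \<open>smaller y x\<close> means that the variable \<open>y\<close> is smaller
  than the variable \<open>x\<close>: among monomials of the same degree, the smaller one has the larger
  exponent at the smallest variable in which the exponents differ.
\<close>

definition degrevlex_less ::
    "('v \<Rightarrow> 'v \<Rightarrow> bool) \<Rightarrow> ('v \<Rightarrow>\<^sub>0 nat) \<Rightarrow> ('v \<Rightarrow>\<^sub>0 nat) \<Rightarrow> bool" where
  "degrevlex_less smaller u v \<longleftrightarrow>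
     mono_deg u < mono_deg v \<or>
     mono_deg u = mono_deg v \<and>
       (\<exists>x. Poly_Mapping.lookup u x > Poly_Mapping.lookup v x \<and>
         (\<forall>y. smaller y x \<longrightarrow> Poly_Mapping.lookup u y = Poly_Mapping.lookup v y))"

definition is_lead_monomial ::
    "(('v \<Rightarrow>\<^sub>0 nat) \<Rightarrow> ('v \<Rightarrow>\<^sub>0 nat) \<Rightarrow> bool) \<Rightarrow>
     ('v, 'k::field) mpoly \<Rightarrow> ('v \<Rightarrow>\<^sub>0 nat) \<Rightarrow> bool" where
  "is_lead_monomial lt p u \<longleftrightarrow>
     u \<in> Poly_Mapping.keys p \<and> (\<forall>v\<in>Poly_Mapping.keys p. v \<noteq> u \<longrightarrow> lt v u)"

definition initial_ideal ::
    "'v set \<Rightarrow> (('v \<Rightarrow>\<^sub>0 nat) \<Rightarrow> ('v \<Rightarrow>\<^sub>0 nat) \<Rightarrow> bool) \<Rightarrow>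
     ('v, 'k::field) mpoly set \<Rightarrow> ('v, 'k) mpoly set" where
  "initial_ideal X lt J =
     Idl\<^bsub>poly_ring X\<^esub> {term_poly u | u p. p \<in> J \<and> is_lead_monomial lt p u}"


section \<open>The initial ideal of the 2-minors\<close>

definition grid :: "nat \<Rightarrow> nat \<Rightarrow> (nat \<times> nat) set" where
  "grid m n = {1..m} \<times> {1..n}"

definition ideal_2minors :: "nat \<Rightarrow> nat \<Rightarrow> (nat \<times> nat, 'k::field) mpoly set" where
  "ideal_2minors m n = Idl\<^bsub>poly_ring (grid m n)\<^esub>
     {var (i, j) * var (k, l) - var (i, l) * var (k, j) | i j k l.
        1 \<le> i \<and> i < k \<and> k \<le> m \<and> 1 \<le> j \<and> j < l \<and> l \<le> n}"

fun var_smaller :: "nat \<times> nat \<Rightarrow> nat \<times> nat \<Rightarrow> bool" where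
  "var_smaller (i, j) (k, l) \<longleftrightarrow>
     (if i = j then k \<noteq> l \<or> k < i
      else k \<noteq> l \<and> (k < i \<or> k = i \<and> l < j))"

definition in_2minors :: "nat \<Rightarrow> nat \<Rightarrow> (nat \<times> nat, 'k::field) mpoly set" where
  "in_2minors m n =
     initial_ideal (grid m n) (degrevlex_less var_smaller) (ideal_2minors m n)"


section \<open>Simplicial complexes and shellings\<close>

text \<open>
  A simplicial complex is given by its set of faces. The complex without any face is \<open>{}\<close>, whereas
  \<open>{{}}\<close> has the empty set as its only face.
\<close>

definition simplicial_complex :: "'a set set \<Rightarrow> bool" where
  "simplicial_complex C \<longleftrightarrow> finite (\<Union>C) \<and> (\<forall>\<sigma>\<in>C. \<forall>\<tau>. \<tau> \<subseteq> \<sigma> \<longrightarrow> \<tau> \<in> C)"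

definition generated_complex :: "'a set set \<Rightarrow> 'a set set" where
  "generated_complex A = {\<sigma>. \<exists>F\<in>A. \<sigma> \<subseteq> F}"

definition facets :: "'a set set \<Rightarrow> 'a set set" where
  "facets C = {F \<in> C. \<forall>G\<in>C. F \<subseteq> G \<longrightarrow> G = F}"

definition pure_of_dim :: "'a set set \<Rightarrow> int \<Rightarrow> bool" where
  "pure_of_dim C d \<longleftrightarrow>
     simplicial_complex C \<and> C \<noteq> {} \<and> (\<forall>F\<in>facets C. int (card F) - 1 = d)"

text \<open>
  A total order on the (finitely many) facets is given as a strict linear order \<open>r\<close>, where
  \<open>(G, F) \<in> r\<close> means that \<open>G\<close> comes before \<open>F\<close>.
\<close>

definition shelling_order :: "int \<Rightarrow> 'a set set \<Rightarrow> ('a set \<times> 'a set) set \<Rightarrow> bool" where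
  "shelling_order d C r \<longleftrightarrow>
     pure_of_dim C d \<and>
     r \<subseteq> facets C \<times> facets C \<and> strict_linear_order_on (facets C) r \<and>
     (\<forall>F\<in>facets C. (\<exists>G. (G, F) \<in> r) \<longrightarrow>
        pure_of_dim (generated_complex {F} \<inter> generated_complex {G. (G, F) \<in> r}) (d - 1))"

definition two_way_shelling :: "int \<Rightarrow> 'a set set \<Rightarrow> ('a set \<times> 'a set) set \<Rightarrow> bool" where
  "two_way_shelling d C r \<longleftrightarrow> shelling_order d C r \<and> shelling_order d C (r\<inverse>)"


section \<open>The complex and its facets\<close>

definition Delta_I :: "'k::field itself \<Rightarrow> nat \<Rightarrow> nat \<Rightarrow> (nat \<times> nat) set set" where
  "Delta_I _ m n =
     {\<sigma>. \<sigma> \<subseteq> grid m n \<and> (\<Prod>x\<in>\<sigma>. var x) \<notin> (in_2minors m n :: (nat \<times> nat, 'k) mpoly set)}"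

definition Delta :: "'k::field itself \<Rightarrow> nat \<Rightarrow> nat \<Rightarrow> (nat \<times> nat) set set" where
  "Delta K m n = {\<sigma> \<in> Delta_I K m n. \<sigma> \<subseteq> grid m n - {(k, k) | k. k \<in> {1..m}}}"

definition rows :: "(nat \<times> nat) set \<Rightarrow> nat set" where
  "rows F = fst ` F"

definition cols :: "(nat \<times> nat) set \<Rightarrow> nat set" where
  "cols F = snd ` F"

definition consecutive_in :: "nat set \<Rightarrow> nat \<Rightarrow> nat \<Rightarrow> bool" where
  "consecutive_in A a b \<longleftrightarrow> a \<in> A \<and> b \<in> A \<and> a < b \<and> \<not> (\<exists>c\<in>A. a < c \<and> c < b)"

text \<open>
  \<open>step_right F v w\<close>: both are vertices of \<open>F\<close> and \<open>w\<close> is one step to the right of \<open>v\<close> within the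
  submatrix with row set \<open>rows F\<close> and column set \<open>cols F\<close>. Since a facet is a path that only moves
  right and down in this submatrix, \<open>w\<close> is then the vertex following \<open>v\<close> in the path, and \<open>v\<close> the
  one preceding \<open>w\<close>. Similarly for \<open>step_down\<close>.
\<close>

definition step_right :: "(nat \<times> nat) set \<Rightarrow> nat \<times> nat \<Rightarrow> nat \<times> nat \<Rightarrow> bool" where
  "step_right F v w \<longleftrightarrow>
     v \<in> F \<and> w \<in> F \<and> fst w = fst v \<and> consecutive_in (cols F) (snd v) (snd w)"

definition step_down :: "(nat \<times> nat) set \<Rightarrow> nat \<times> nat \<Rightarrow> nat \<times> nat \<Rightarrow> bool" where
  "step_down F v w \<longleftrightarrow>
     v \<in> F \<and> w \<in> F \<and> snd w = snd v \<and> consecutive_in (rows F) (fst v) (fst w)"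

definition right_turning :: "(nat \<times> nat) set \<Rightarrow> nat \<times> nat \<Rightarrow> bool" where
  "right_turning F v \<longleftrightarrow> (\<exists>u. step_right F u v) \<and> (\<exists>w. step_down F v w)"

definition left_turning :: "(nat \<times> nat) set \<Rightarrow> nat \<times> nat \<Rightarrow> bool" where
  "left_turning F v \<longleftrightarrow> (\<exists>u. step_down F u v) \<and> (\<exists>w. step_right F v w)"

definition horizontal :: "(nat \<times> nat) set \<Rightarrow> nat \<times> nat \<Rightarrow> bool" where
  "horizontal F v \<longleftrightarrow> v \<in> F \<and> (\<forall>w\<in>F. snd w = snd v \<longrightarrow> w = v)"

definition vertical :: "(nat \<times> nat) set \<Rightarrow> nat \<times> nat \<Rightarrow> bool" where
  "vertical F v \<longleftrightarrow> v \<in> F \<and> (\<forall>w\<in>F. fst w = fst v \<longrightarrow> w = v)"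

definition F_plus :: "nat \<Rightarrow> (nat \<times> nat) set \<Rightarrow> (nat \<times> nat) set" where
  "F_plus m F =
     {v \<in> F. right_turning F v} \<union>
     {(i, j) \<in> F. horizontal F (i, j) \<and> Max (rows F) < j \<and> j \<le> m} \<union>
     {(i, j) \<in> F. vertical F (i, j) \<and> i < Max (rows F)}"

definition F_minus :: "(nat \<times> nat) set \<Rightarrow> (nat \<times> nat) set" where
  "F_minus F =
     {v \<in> F. left_turning F v} \<union>
     {(i, j) \<in> F. horizontal F (i, j) \<and> j < Max (rows F)} \<union>
     {(i, j) \<in> F. vertical F (i, j) \<and> i = Max (rows F)}"


section \<open>The order on the facets\<close>

text \<open>
  Lexicographic order of the increasing enumerations; a proper prefix is smaller.
\<close>

definition rows_less :: "nat set \<Rightarrow> nat set \<Rightarrow> bool" where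
  "rows_less r\<^sub>1 r\<^sub>2 \<longleftrightarrow>
     (sorted_list_of_set r\<^sub>1, sorted_list_of_set r\<^sub>2) \<in> lexord {(a, b). a < b}"

text \<open>
  The vertices of a path up to and including its vertex \<open>u\<close>: for a right-and-down path these are
  the ones weakly above and weakly to the left of \<open>u\<close>.
\<close>

definition path_upto :: "(nat \<times> nat) set \<Rightarrow> nat \<times> nat \<Rightarrow> (nat \<times> nat) set" where
  "path_upto F u = {v \<in> F. fst v \<le> fst u \<and> snd v \<le> snd u}"

text \<open>
  In the second case, \<open>u\<close> is the last vertex before the paths separate.
\<close>

definition facet_less :: "(nat \<times> nat) set \<Rightarrow> (nat \<times> nat) set \<Rightarrow> bool" where
  "facet_less F G \<longleftrightarrow>
     rows_less (rows F) (rows G) \<or>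
     rows F = rows G \<and>
       (\<exists>u. path_upto F u = path_upto G u \<and> (\<exists>v. step_right F u v) \<and> (\<exists>w. step_down G u w))"

end

theory Submission
  imports Defs
begin

text \<open>
  The ideal of 2-minors is the kernel of \<open>x\<^sub>i\<^sub>j \<mapsto> s\<^sub>i t\<^sub>j\<close>, whose fibres on monomials consist of the
  matrices with given row and column sums; so a monomial lies outside the initial ideal iff it is the
  smallest one of its fibre. For a square-free monomial off the diagonal this means that its rows
  and columns are disjoint (otherwise \<open>x\<^sub>a\<^sub>b x\<^sub>b\<^sub>c\<close> can be replaced by \<open>x\<^sub>a\<^sub>c x\<^sub>b\<^sub>b\<close>) and that it is a chain
  in the south-east order (otherwise an antidiagonal of a minor can be replaced by the diagonal).
  Facets are therefore the maximal such chains, and they all have \<open>n - 1\<close> vertices.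

  A vertex \<open>v\<close> of \<open>F\<^sup>-\<close> or \<open>F\<^sup>+\<close> can be exchanged: a turn is flipped, a horizontal vertex in column \<open>j\<close> is
  replaced by one in a new row \<open>j\<close>, and a vertical vertex in row \<open>i\<close> by one in a new column \<open>i\<close>. The
  lexicographic order of the row sets tells which of the two facets comes first. Conversely, where a
  facet \<open>G\<close> first deviates from \<open>F\<close> one finds a row, a column or a turn of \<open>F\<close> that \<open>G\<close> avoids and that
  contains a vertex of \<open>F\<^sup>-\<close> or \<open>F\<^sup>+\<close>, depending on the side on which \<open>G\<close> lies.
\<close>

section \<open>The initial ideal\<close>

lemma carrier_poly_ring_iff:
  "p \<in> carrier (poly_ring X) \<longleftrightarrow> (\<forall>u\<in>Poly_Mapping.keys p. Poly_Mapping.keys u \<subseteq> X)"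
  by (simp add: poly_ring_def)

lemma poly_ring_closed:
  fixes p q :: "('v, 'k::field) mpoly"
  assumes "p \<in> carrier (poly_ring X)" "q \<in> carrier (poly_ring X)"
  shows poly_ring_add_closed: "p + q \<in> carrier (poly_ring X)"
    and poly_ring_mult_closed: "p * q \<in> carrier (poly_ring X)"
  using cring.cring_simprules(1,5)[OF cring_poly_ring assms] by (simp_all add: poly_ring_def)

lemma ring_poly_ring: "ring (poly_ring X :: ('v, 'k::field) mpoly ring)"
  by (rule cring.axioms(1)[OF cring_poly_ring])

text \<open>Since \<open>- 1\<close> belongs to the polynomial ring, closure under multiplication
  already yields negatives, so the additive subgroup condition reduces to zero and sums.\<close>

lemma ideal_poly_ringI:
  fixes J :: "('v, 'k::field) mpoly set"
  assumes sub: "J \<subseteq> carrier (poly_ring X)" and zero: "0 \<in> J"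
    and add: "\<And>p q. p \<in> J \<Longrightarrow> q \<in> J \<Longrightarrow> p + q \<in> J"
    and mult: "\<And>p q. p \<in> J \<Longrightarrow> q \<in> carrier (poly_ring X) \<Longrightarrow> p * q \<in> J"
  shows "ideal J (poly_ring X)"
proof -
  have uminus: "- p \<in> J" if "p \<in> J" for p
  proof -
    have "- 1 \<in> carrier (poly_ring X :: ('v, 'k) mpoly ring)"
      by (simp add: poly_ring_def)
    from mult[OF that this] show ?thesis by simp
  qed
  have inv: "\<ominus>\<^bsub>poly_ring X\<^esub> p = - p" if "p \<in> J" for p
    using uminus[OF that] that sub
    by (intro abelian_group.minus_equality[OF ring.is_abelian_group[OF ring_poly_ring]])
      (auto simp: poly_ring_def)
  show ?thesis
  proof (rule idealI)
    show "subgroup J (add_monoid (poly_ring X))"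
    proof (rule subgroup.intro)
      show "inv\<^bsub>add_monoid (poly_ring X)\<^esub> p \<in> J" if "p \<in> J" for p
        using inv[OF that] uminus[OF that] by (simp add: a_inv_def)
    qed (use sub zero add in \<open>simp_all add: poly_ring_def\<close>)
    show "q \<otimes>\<^bsub>poly_ring X\<^esub> p \<in> J" "p \<otimes>\<^bsub>poly_ring X\<^esub> q \<in> J"
      if "p \<in> J" "q \<in> carrier (poly_ring X)" for p q
      using mult[OF that] by (simp_all add: poly_ring_def mult.commute)
  qed (rule ring_poly_ring)
qed

lemma Idl_poly_ring:
  fixes A :: "('v, 'k::field) mpoly set"
  assumes "A \<subseteq> carrier (poly_ring X)"
  shows Idl_poly_ring_ideal: "ideal (Idl\<^bsub>poly_ring X\<^esub> A) (poly_ring X)"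
    and Idl_poly_ring_subset: "A \<subseteq> Idl\<^bsub>poly_ring X\<^esub> A"
    and Idl_poly_ring_minimal: "ideal J (poly_ring X) \<Longrightarrow> A \<subseteq> J \<Longrightarrow> Idl\<^bsub>poly_ring X\<^esub> A \<subseteq> J"
  using ring.genideal_ideal[OF ring_poly_ring assms] ring.genideal_self[OF ring_poly_ring assms]
    ring.genideal_minimal[OF ring_poly_ring] by blast+

lemma ideal_poly_ring_mult:
  fixes J :: "('v, 'k::field) mpoly set"
  assumes "ideal J (poly_ring X)" "p \<in> J" "q \<in> carrier (poly_ring X)"
  shows "p * q \<in> J"
  using ideal.I_r_closed[OF assms] by (simp add: poly_ring_def)

section \<open>Degrees, row sums and column sums of monomials\<close>

lemma mono_deg_add: "mono_deg (u + v) = mono_deg u + mono_deg v"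
proof -
  have deg: "mono_deg w = (\<Sum>x\<in>Poly_Mapping.keys u \<union> Poly_Mapping.keys v. Poly_Mapping.lookup w x)"
    if "Poly_Mapping.keys w \<subseteq> Poly_Mapping.keys u \<union> Poly_Mapping.keys v" for w
    unfolding mono_deg_def using that by (intro sum.mono_neutral_left) (auto simp: in_keys_iff)
  show ?thesis
    using deg[of u] deg[of v] deg[of "u + v"] Poly_Mapping.keys_add[of u v]
    by (simp add: lookup_add sum.distrib)
qed

lemma degrevlex_less_add:
  "degrevlex_less smaller u v \<Longrightarrow> degrevlex_less smaller (u + w) (v + w)"
  by (auto simp: degrevlex_less_def mono_deg_add lookup_add)

text \<open>For monomials in the grid variables this is equality of the images under
  \<open>x_ij -> s_i t_j\<close>; the fibres of this map are used without ever forming the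
  map.\<close>

definition same_margins :: "nat \<Rightarrow> nat \<Rightarrow> (nat \<times> nat \<Rightarrow>\<^sub>0 nat) \<Rightarrow> (nat \<times> nat \<Rightarrow>\<^sub>0 nat) \<Rightarrow> bool" where
  "same_margins m n u v \<longleftrightarrow>
     (\<forall>i. (\<Sum>j\<in>{1..n}. Poly_Mapping.lookup u (i, j)) = (\<Sum>j\<in>{1..n}. Poly_Mapping.lookup v (i, j))) \<and>
     (\<forall>j. (\<Sum>i\<in>{1..m}. Poly_Mapping.lookup u (i, j)) = (\<Sum>i\<in>{1..m}. Poly_Mapping.lookup v (i, j)))"

lemma same_margins_add: "same_margins m n u v \<Longrightarrow> same_margins m n (u + w) (v + w)"
  by (simp add: same_margins_def lookup_add sum.distrib)

lemma same_margins_swap: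
  assumes "i \<in> {1..m}" "k \<in> {1..m}" "j \<in> {1..n}" "l \<in> {1..n}"
  shows "same_margins m n (Poly_Mapping.single (i, j) 1 + Poly_Mapping.single (k, l) 1)
    (Poly_Mapping.single (i, l) 1 + Poly_Mapping.single (k, j) 1)"
proof -
  have row: "(\<Sum>j\<in>{1..n}. Poly_Mapping.lookup (Poly_Mapping.single (a, b) (1::nat)) (i, j)) =
      (if i = a then 1 else 0)" if "b \<in> {1..n}" for a b i
    using that by (auto simp: lookup_single when_def sum.delta)
  have col: "(\<Sum>i\<in>{1..m}. Poly_Mapping.lookup (Poly_Mapping.single (a, b) (1::nat)) (i, j)) =
      (if j = b then 1 else 0)" if "a \<in> {1..m}" for a b j
    using that by (auto simp: lookup_single when_def sum.delta)
  show ?thesis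
    using assms by (simp add: same_margins_def lookup_add sum.distrib row col del: One_nat_def)
qed

lemma same_margins_mono_deg:
  assumes "same_margins m n u v"
    and "Poly_Mapping.keys u \<subseteq> grid m n" "Poly_Mapping.keys v \<subseteq> grid m n"
  shows "mono_deg u = mono_deg v"
proof -
  have deg: "mono_deg w = (\<Sum>i\<in>{1..m}. \<Sum>j\<in>{1..n}. Poly_Mapping.lookup w (i, j))"
    if "Poly_Mapping.keys w \<subseteq> grid m n" for w
  proof -
    have "mono_deg w = (\<Sum>x\<in>grid m n. Poly_Mapping.lookup w x)"
      unfolding mono_deg_def using that
      by (intro sum.mono_neutral_left) (auto simp: in_keys_iff grid_def)
    then show ?thesis by (simp add: grid_def sum.cartesian_product)
  qed
  show ?thesis
    using assms deg[of u] deg[of v] by (simp add: same_margins_def)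
qed

section \<open>Linear functionals that vanish on the 2-minors\<close>

text \<open>The linear functional with value \<open>h u\<close> on the monomial \<open>u\<close>.
  Functionals whose \<open>h\<close> is constant on the fibres stand in for the map
  \<open>x_ij -> s_i t_j\<close>.\<close>

definition weighted_sum :: "('u \<Rightarrow> 'k) \<Rightarrow> ('u \<Rightarrow>\<^sub>0 'k) \<Rightarrow> 'k::field" where
  "weighted_sum h p = (\<Sum>u\<in>Poly_Mapping.keys p. Poly_Mapping.lookup p u * h u)"

lemma weighted_sum_superset:
  "finite K \<Longrightarrow> Poly_Mapping.keys p \<subseteq> K \<Longrightarrow>
    weighted_sum h p = (\<Sum>u\<in>K. Poly_Mapping.lookup p u * h u)"
  unfolding weighted_sum_def by (intro sum.mono_neutral_left) (auto simp: in_keys_iff)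

lemma weighted_sum_add: "weighted_sum h (p + q) = weighted_sum h p + weighted_sum h q"
proof -
  let ?K = "Poly_Mapping.keys p \<union> Poly_Mapping.keys q"
  show ?thesis
    using weighted_sum_superset[of ?K p h] weighted_sum_superset[of ?K q h]
      weighted_sum_superset[of ?K "p + q" h] Poly_Mapping.keys_add[of p q]
    by (simp add: lookup_add sum.distrib distrib_right)
qed

lemma weighted_sum_zero [simp]: "weighted_sum h 0 = 0"
  by (simp add: weighted_sum_def)

lemma weighted_sum_sum: "weighted_sum h (sum f A) = (\<Sum>a\<in>A. weighted_sum h (f a))"
  by (induction A rule: infinite_finite_induct) (simp_all add: weighted_sum_add)

lemma weighted_sum_single [simp]: "weighted_sum h (Poly_Mapping.single u c) = c * h u"
  by (simp add: weighted_sum_def)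

lemma sum_single_keys:
  "(\<Sum>u\<in>Poly_Mapping.keys p. Poly_Mapping.single u (Poly_Mapping.lookup p u)) = p"
proof (rule poly_mapping_eqI)
  fix k
  show "Poly_Mapping.lookup (\<Sum>u\<in>Poly_Mapping.keys p. Poly_Mapping.single u (Poly_Mapping.lookup p u)) k
      = Poly_Mapping.lookup p k"
    by (simp add: lookup_sum lookup_single when_def sum.delta in_keys_iff)
qed

text \<open>Multiplication by a monomial \<open>v\<close> shifts the weight function by
  \<open>v\<close>. Hence the common kernel of a shift-closed class of weights is closed under
  multiplication.\<close>

lemma weighted_sum_mult:
  fixes p q :: "('v, 'k::field) mpoly"
  shows "weighted_sum h (p * q) =
    (\<Sum>v\<in>Poly_Mapping.keys q. Poly_Mapping.lookup q v * weighted_sum (\<lambda>u. h (u + v)) p)"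
proof -
  let ?c = "\<lambda>p u. Poly_Mapping.single u (Poly_Mapping.lookup p u)"
  have "p * q = (\<Sum>u\<in>Poly_Mapping.keys p. ?c p u) * (\<Sum>v\<in>Poly_Mapping.keys q. ?c q v)"
    by (simp only: sum_single_keys)
  also have "\<dots> = (\<Sum>v\<in>Poly_Mapping.keys q. \<Sum>u\<in>Poly_Mapping.keys p. ?c p u * ?c q v)"
    by (subst sum.swap) (simp add: sum_product)
  finally show ?thesis
    by (simp add: weighted_sum_sum mult_single weighted_sum_def[of _ p] sum_distrib_left ac_simps)
qed

section \<open>The ideal of 2-minors and its initial ideal\<close>

lemma ideal_2minors_gens_subset:
  "{var (i, j) * var (k, l) - var (i, l) * var (k, j) | i j k l.
      1 \<le> i \<and> i < k \<and> k \<le> m \<and> 1 \<le> j \<and> j < l \<and> l \<le> n}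
    \<subseteq> carrier (poly_ring (grid m n) :: (nat \<times> nat, 'k::field) mpoly ring)"
proof -
  have "term_poly (Poly_Mapping.single a 1 + Poly_Mapping.single b 1)
      - term_poly (Poly_Mapping.single c 1 + Poly_Mapping.single d 1)
      \<in> carrier (poly_ring X :: (nat \<times> nat, 'k) mpoly ring)" (is "term_poly ?u - term_poly ?v \<in> _")
    if "a \<in> X" "b \<in> X" "c \<in> X" "d \<in> X" for a b c d X
  proof -
    have "Poly_Mapping.keys ?u \<subseteq> X" "Poly_Mapping.keys ?v \<subseteq> X"
      using that Poly_Mapping.keys_add[of "Poly_Mapping.single a (1::nat)" "Poly_Mapping.single b 1"]
        Poly_Mapping.keys_add[of "Poly_Mapping.single c (1::nat)" "Poly_Mapping.single d 1"]
      by (simp_all add: subset_iff) metis+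
    moreover have "Poly_Mapping.keys (term_poly ?u - term_poly ?v :: (nat \<times> nat, 'k) mpoly) \<subseteq> {?u, ?v}"
      using Poly_Mapping.keys_diff[of "term_poly ?u" "term_poly ?v :: (nat \<times> nat, 'k) mpoly"]
      by (simp add: term_poly_def insert_commute)
    ultimately show ?thesis
      unfolding carrier_poly_ring_iff by blast
  qed
  moreover have "var a * var b = (term_poly (Poly_Mapping.single a 1 + Poly_Mapping.single b 1) :: (nat \<times> nat, 'k) mpoly)"
    for a b
    by (simp add: var_def term_poly_def mult_single)
  ultimately show ?thesis
    by (clarsimp simp: grid_def simp del: One_nat_def)
qed

definition margin_invariant :: "nat \<Rightarrow> nat \<Rightarrow> ((nat \<times> nat \<Rightarrow>\<^sub>0 nat) \<Rightarrow> 'a) \<Rightarrow> bool" where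
  "margin_invariant m n h \<longleftrightarrow> (\<forall>u v. same_margins m n u v \<longrightarrow> h u = h v)"

lemma margin_invariant_shift: "margin_invariant m n h \<Longrightarrow> margin_invariant m n (\<lambda>u. h (u + v))"
  using same_margins_add unfolding margin_invariant_def by blast

text \<open>The common kernel \<open>J\<close> of all margin-invariant weights is an ideal because
  these weights are closed under shifts, and it contains each minor because the two terms of a minor
  have the same margins.\<close>

lemma weighted_sum_ideal_2minors:
  fixes p :: "(nat \<times> nat, 'k::field) mpoly"
  assumes "p \<in> ideal_2minors m n" and "margin_invariant m n h"
  shows "weighted_sum h p = 0"
proof -
  define J :: "(nat \<times> nat, 'k) mpoly set" where
    "J = {p \<in> carrier (poly_ring (grid m n)).
      \<forall>h. margin_invariant m n h \<longrightarrow> weighted_sum h p = 0}"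
  have "ideal J (poly_ring (grid m n))"
  proof (rule ideal_poly_ringI)
    show "J \<subseteq> carrier (poly_ring (grid m n))" "0 \<in> J"
      by (auto simp: J_def poly_ring_def)
  next
    fix p q assume pq: "p \<in> J" "q \<in> J"
    then show "p + q \<in> J"
      by (simp add: J_def weighted_sum_add poly_ring_add_closed)
  next
    fix p q :: "(nat \<times> nat, 'k) mpoly"
    assume pq: "p \<in> J" "q \<in> carrier (poly_ring (grid m n))"
    have "weighted_sum h (p * q) = 0" if "margin_invariant m n h" for h
    proof -
      have "weighted_sum (\<lambda>u. h (u + v)) p = 0" for v
        using pq(1) margin_invariant_shift[OF that] unfolding J_def by blast
      then show ?thesis by (simp add: weighted_sum_mult)
    qed
    then show "p * q \<in> J"
      using pq by (simp add: J_def poly_ring_mult_closed)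
  qed
  moreover have "{var (i, j) * var (k, l) - var (i, l) * var (k, j) | i j k l.
      1 \<le> i \<and> i < k \<and> k \<le> m \<and> 1 \<le> j \<and> j < l \<and> l \<le> n} \<subseteq> J"
  proof safe
    fix i j k l
    assume ijkl: "1 \<le> i" "i < k" "k \<le> m" "1 \<le> j" "j < l" "l \<le> n"
    have "weighted_sum h (p - q) = weighted_sum h p - weighted_sum h q"
      for h and p q :: "(nat \<times> nat, 'k) mpoly"
      using weighted_sum_add[of h "p - q" q] by simp
    moreover have "same_margins m n (Poly_Mapping.single (i, j) 1 + Poly_Mapping.single (k, l) 1)
      (Poly_Mapping.single (i, l) 1 + Poly_Mapping.single (k, j) 1)"
      using ijkl by (intro same_margins_swap) auto
    moreover have "var (i, j) * var (k, l) - var (i, l) * var (k, j) \<in>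
      carrier (poly_ring (grid m n) :: (nat \<times> nat, 'k) mpoly ring)"
      using ijkl by (intro subsetD[OF ideal_2minors_gens_subset]) blast
    ultimately show "var (i, j) * var (k, l) - var (i, l) * var (k, j) \<in> J"
      by (simp add: J_def var_def term_poly_def mult_single margin_invariant_def)
  qed
  ultimately have "ideal_2minors m n \<subseteq> J"
    unfolding ideal_2minors_def by (intro Idl_poly_ring_minimal ideal_2minors_gens_subset)
  with assms show ?thesis
    unfolding J_def by blast
qed

lemma ideal_2minors_ideal:
  "ideal (ideal_2minors m n :: (nat \<times> nat, 'k::field) mpoly set) (poly_ring (grid m n))"
  unfolding ideal_2minors_def by (rule Idl_poly_ring_ideal[OF ideal_2minors_gens_subset])

lemma ideal_2minors_carrier:
  "(ideal_2minors m n :: (nat \<times> nat, 'k::field) mpoly set) \<subseteq> carrier (poly_ring (grid m n))"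
  using ideal_2minors_ideal[of m n] by (meson additive_subgroup.a_subset ideal.axioms(1))

lemma initial_gens_subset:
  fixes J :: "('v, 'k::field) mpoly set"
  shows "J \<subseteq> carrier (poly_ring X) \<Longrightarrow>
    {term_poly u | u p. p \<in> J \<and> is_lead_monomial lt p u} \<subseteq> carrier (poly_ring X)"
  by (force simp: carrier_poly_ring_iff term_poly_def is_lead_monomial_def)

text \<open>Polynomials all of whose monomials fail to be smallest in their fibre form an ideal,
  since margins and monomial order are compatible with multiplication. It remains to see that
  leading monomials of the ideal of 2-minors are of this kind.\<close>

lemma in_2minors_keys_not_minimal:
  fixes p :: "(nat \<times> nat, 'k::field) mpoly"
  assumes "p \<in> in_2minors m n" "u \<in> Poly_Mapping.keys p"
  shows "\<exists>v. Poly_Mapping.keys v \<subseteq> grid m n \<and> same_margins m n v u \<and>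
    degrevlex_less var_smaller v u"
proof -
  let ?nm = "\<lambda>u. \<exists>v. Poly_Mapping.keys v \<subseteq> grid m n \<and> same_margins m n v u \<and>
    degrevlex_less var_smaller v u"
  define J :: "(nat \<times> nat, 'k) mpoly set" where
    "J = {p \<in> carrier (poly_ring (grid m n)). \<forall>u\<in>Poly_Mapping.keys p. ?nm u}"
  have "ideal J (poly_ring (grid m n))"
  proof (rule ideal_poly_ringI)
    show "J \<subseteq> carrier (poly_ring (grid m n))" "0 \<in> J"
      by (auto simp: J_def poly_ring_def)
  next
    fix p q assume pq: "p \<in> J" "q \<in> J"
    then have "p + q \<in> carrier (poly_ring (grid m n))"
      by (simp add: J_def poly_ring_add_closed)
    with pq show "p + q \<in> J"
      using Poly_Mapping.keys_add[of p q] unfolding J_def by blast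
  next
    fix p q :: "(nat \<times> nat, 'k) mpoly"
    assume pq: "p \<in> J" "q \<in> carrier (poly_ring (grid m n))"
    have "?nm w" if w: "w \<in> Poly_Mapping.keys (p * q)" for w
    proof -
      from w obtain a b where ab: "a \<in> Poly_Mapping.keys p" "b \<in> Poly_Mapping.keys q" "w = a + b"
        using Poly_Mapping.keys_mult[of p q] by blast
      obtain v where v: "Poly_Mapping.keys v \<subseteq> grid m n" "same_margins m n v a"
        "degrevlex_less var_smaller v a"
        using pq(1) ab(1) unfolding J_def by blast
      moreover have "Poly_Mapping.keys (v + b) \<subseteq> grid m n"
        using Poly_Mapping.keys_add[of v b] v(1) pq(2) ab(2) by (auto simp: poly_ring_def)
      ultimately show ?thesis
        unfolding ab(3) using same_margins_add degrevlex_less_add by blast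
    qed
    then show "p * q \<in> J"
      using pq by (simp add: J_def poly_ring_mult_closed)
  qed
  moreover have "{term_poly u | u p. p \<in> (ideal_2minors m n :: (nat \<times> nat, 'k) mpoly set) \<and>
      is_lead_monomial (degrevlex_less var_smaller) p u} \<subseteq> J" (is "?gens \<subseteq> J")
  proof
    fix t assume t: "t \<in> ?gens"
    then obtain u and p :: "(nat \<times> nat, 'k) mpoly" where p: "t = term_poly u"
      "p \<in> ideal_2minors m n" "is_lead_monomial (degrevlex_less var_smaller) p u"
      by blast
    \<comment> \<open>The indicator of the fibre of \<open>u\<close> annihilates \<open>p\<close>,
      so the coefficient at \<open>u\<close> must be cancelled by another monomial of the same
      fibre; as \<open>u\<close> leads, that one is smaller.\<close>
    let ?h = "\<lambda>v. if same_margins m n v u then 1 else 0 :: 'k"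
    have "weighted_sum ?h p = 0"
      using p(2) by (rule weighted_sum_ideal_2minors) (auto simp: margin_invariant_def same_margins_def)
    moreover have "weighted_sum ?h p = Poly_Mapping.lookup p u +
        (\<Sum>v\<in>Poly_Mapping.keys p - {u}. Poly_Mapping.lookup p v * ?h v)"
      unfolding weighted_sum_def using p(3)
      by (subst sum.remove[of _ u]) (auto simp: is_lead_monomial_def same_margins_def)
    moreover have "Poly_Mapping.lookup p u \<noteq> 0"
      using p(3) by (simp add: is_lead_monomial_def in_keys_iff)
    ultimately have "(\<Sum>v\<in>Poly_Mapping.keys p - {u}. Poly_Mapping.lookup p v * ?h v) \<noteq> 0"
      by auto
    then obtain v where "v \<in> Poly_Mapping.keys p - {u}" "Poly_Mapping.lookup p v * ?h v \<noteq> 0"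
      by (rule sum.not_neutral_contains_not_neutral)
    then have "\<exists>v\<in>Poly_Mapping.keys p - {u}. same_margins m n v u"
      by (auto split: if_splits)
    then have "?nm u"
      using p(2,3) subsetD[OF ideal_2minors_carrier p(2)]
      by (auto simp: is_lead_monomial_def poly_ring_def)
    moreover have "t \<in> carrier (poly_ring (grid m n))"
      using t initial_gens_subset[OF ideal_2minors_carrier] by blast
    ultimately show "t \<in> J"
      by (simp add: J_def p(1) term_poly_def)
  qed
  ultimately have "in_2minors m n \<subseteq> J"
    unfolding in_2minors_def initial_ideal_def
    by (intro Idl_poly_ring_minimal initial_gens_subset ideal_2minors_carrier)
  with assms show ?thesis
    unfolding J_def by blast
qed

text \<open>Exchanging the two rows or the two columns changes a minor only by its sign.\<close>

lemma minor_in_ideal_2minors: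
  assumes "i \<in> {1..m}" "k \<in> {1..m}" "j \<in> {1..n}" "l \<in> {1..n}" "i \<noteq> k" "j \<noteq> l"
  shows "(var (i, j) * var (k, l) - var (i, l) * var (k, j) :: (nat \<times> nat, 'k::field) mpoly)
    \<in> ideal_2minors m n"
proof -
  let ?min = "\<lambda>i j k l. var (i, j) * var (k, l) - var (i, l) * var (k, j) :: (nat \<times> nat, 'k) mpoly"
  have neg: "- p \<in> ideal_2minors m n" if "p \<in> ideal_2minors m n"
    for p :: "(nat \<times> nat, 'k) mpoly"
    using ideal_poly_ring_mult[OF ideal_2minors_ideal that, of "- 1"]
    by (simp add: poly_ring_def)
  have ordered: "?min i j k l \<in> ideal_2minors m n"
    if "i \<in> {1..m}" "k \<in> {1..m}" "j \<in> {1..n}" "l \<in> {1..n}" "i < k" "j < l" for i j k l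
    unfolding ideal_2minors_def
    using that by (intro subsetD[OF Idl_poly_ring_subset[OF ideal_2minors_gens_subset]]) force
  consider "i < k" "j < l" | "i < k" "l < j" | "k < i" "j < l" | "k < i" "l < j"
    using assms by linarith
  then show ?thesis
  proof cases
    case 1 then show ?thesis using ordered assms by blast
  next
    case 2 then show ?thesis using neg[OF ordered[of i k l j]] assms by simp
  next
    case 3 then show ?thesis using neg[OF ordered[of k i j l]] assms by (simp add: mult.commute)
  next
    case 4 then show ?thesis using ordered[of k i l j] assms by (simp add: mult.commute)
  qed
qed

section \<open>Non-faces from leading terms of minors\<close>

lemma lookup_sum_single:
  "finite \<sigma> \<Longrightarrow> Poly_Mapping.lookup (\<Sum>x\<in>\<sigma>. Poly_Mapping.single x (1::nat)) y = (if y \<in> \<sigma> then 1 else 0)"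
  by (simp add: lookup_sum lookup_single when_def sum.delta)

lemma prod_var:
  "finite \<sigma> \<Longrightarrow> (\<Prod>x\<in>\<sigma>. var x) = term_poly (\<Sum>x\<in>\<sigma>. Poly_Mapping.single x 1)"
  by (induction \<sigma> rule: finite_induct)
    (simp_all add: var_def term_poly_def mult_single)

lemma finite_grid [simp]: "finite (grid m n)"
  by (simp add: grid_def)

text \<open>The two pairs of positions are the two terms of a minor up to sign. By
  \<open>less\<close>, its leading monomial is the one on \<open>(i, j)\<close> and
  \<open>(k, l)\<close>, and this divides the monomial of \<sigma>.\<close>

lemma not_in_Delta_I:
  assumes \<sigma>: "\<sigma> \<subseteq> grid m n" "(i, j) \<in> \<sigma>" "(k, l) \<in> \<sigma>" and neq: "i \<noteq> k" "j \<noteq> l"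
    and less: "degrevlex_less var_smaller
      (Poly_Mapping.single (i, l) 1 + Poly_Mapping.single (k, j) 1)
      (Poly_Mapping.single (i, j) 1 + Poly_Mapping.single (k, l) 1)"
  shows "\<sigma> \<notin> Delta_I TYPE('k::field) m n"
proof -
  let ?u = "Poly_Mapping.single (i, j) (1::nat) + Poly_Mapping.single (k, l) 1"
  let ?v = "Poly_Mapping.single (i, l) (1::nat) + Poly_Mapping.single (k, j) 1"
  let ?p = "term_poly ?u - term_poly ?v :: (nat \<times> nat, 'k) mpoly"
  have fin: "finite \<sigma>"
    using \<sigma>(1) finite_grid by (rule finite_subset)
  have "?p = var (i, j) * var (k, l) - var (i, l) * var (k, j)"
    by (simp add: var_def term_poly_def mult_single)
  then have p: "?p \<in> ideal_2minors m n"
    using minor_in_ideal_2minors[of i m k j n l, where 'k = 'k] subsetD[OF \<sigma>(1) \<sigma>(2)]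
      subsetD[OF \<sigma>(1) \<sigma>(3)] neq by (simp add: grid_def)
  have "Poly_Mapping.lookup ?u (i, j) \<noteq> Poly_Mapping.lookup ?v (i, j)"
    using neq by (auto simp: lookup_add lookup_single when_def)
  then have "?u \<noteq> ?v"
    by metis
  then have "?u \<in> Poly_Mapping.keys ?p"
    by (simp add: term_poly_def in_keys_iff lookup_minus lookup_single when_def)
  moreover have "Poly_Mapping.keys ?p \<subseteq> {?u, ?v}"
    using Poly_Mapping.keys_diff[of "term_poly ?u" "term_poly ?v :: (nat \<times> nat, 'k) mpoly"]
    by (simp add: term_poly_def insert_commute)
  ultimately have "is_lead_monomial (degrevlex_less var_smaller) ?p ?u"
    using less unfolding is_lead_monomial_def by blast
  then have u: "(term_poly ?u :: (nat \<times> nat, 'k) mpoly) \<in> in_2minors m n"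
    unfolding in_2minors_def initial_ideal_def using p
    by (intro subsetD[OF Idl_poly_ring_subset[OF initial_gens_subset[OF ideal_2minors_carrier]]]) blast
  \<comment> \<open>The cofactor: the product of the remaining variables of \<sigma>.\<close>
  let ?r = "\<Sum>x\<in>\<sigma> - {(i, j), (k, l)}. Poly_Mapping.single x (1::nat)"
  have "(\<Sum>x\<in>\<sigma>. Poly_Mapping.single x (1::nat)) = ?u + ?r"
    using sum.subset_diff[of "{(i, j), (k, l)}" \<sigma> "\<lambda>x. Poly_Mapping.single x (1::nat)"] fin \<sigma>(2,3) neq
    by (simp add: add.commute)
  then have prod: "(\<Prod>x\<in>\<sigma>. var x) = (term_poly ?u * term_poly ?r :: (nat \<times> nat, 'k) mpoly)"
    by (simp add: prod_var[OF fin] term_poly_def mult_single)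
  have "(term_poly ?r :: (nat \<times> nat, 'k) mpoly) \<in> carrier (poly_ring (grid m n))"
    using \<sigma>(1) fin by (auto simp: carrier_poly_ring_iff term_poly_def in_keys_iff lookup_sum_single
        simp del: One_nat_def split: if_splits)
  then have "(\<Prod>x\<in>\<sigma>. var x) \<in> (in_2minors m n :: (nat \<times> nat, 'k) mpoly set)"
    unfolding prod using u unfolding in_2minors_def initial_ideal_def
    by (intro ideal_poly_ring_mult[OF Idl_poly_ring_ideal[OF initial_gens_subset[OF ideal_2minors_carrier]]])
  then show ?thesis
    by (simp add: Delta_I_def)
qed

section \<open>Faces as south-east chains\<close>

text \<open>A chain in the componentwise order; positions in one row are comparable anyway, so the
  condition concerns pairs with \<open>i < k\<close>.\<close>

definition southeast_chain :: "(nat \<times> nat) set \<Rightarrow> bool" where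
  "southeast_chain \<sigma> \<longleftrightarrow> (\<forall>i j k l. (i, j) \<in> \<sigma> \<longrightarrow> (k, l) \<in> \<sigma> \<longrightarrow> i < k \<longrightarrow> j \<le> l)"

text \<open>Both monomials have degree 2, and no variable smaller than \<open>x\<close> occurs in
  either, so \<open>x\<close> decides the comparison.\<close>

lemma degrevlex_less_pairI:
  assumes "Poly_Mapping.lookup (Poly_Mapping.single c 1 + Poly_Mapping.single d 1) x >
      Poly_Mapping.lookup (Poly_Mapping.single a 1 + Poly_Mapping.single b (1::nat)) x"
    and "\<And>y. var_smaller y x \<Longrightarrow> y \<notin> {a, b, c, d}"
  shows "degrevlex_less var_smaller (Poly_Mapping.single c 1 + Poly_Mapping.single d 1)
      (Poly_Mapping.single a 1 + Poly_Mapping.single b 1)"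
proof -
  have "mono_deg (Poly_Mapping.single c (1::nat)) = 1" for c :: "nat \<times> nat"
    by (simp add: mono_deg_def)
  then show ?thesis
    unfolding degrevlex_less_def mono_deg_add using assms(1)
    by (intro disjI2 conjI exI[of _ x] allI impI)
      (auto dest!: assms(2) simp: lookup_add lookup_single when_def)
qed

lemma Delta_rows_cols_disjoint:
  assumes "\<sigma> \<in> Delta TYPE('k::field) m n"
  shows "rows \<sigma> \<inter> cols \<sigma> = {}"
proof (rule ccontr)
  assume "rows \<sigma> \<inter> cols \<sigma> \<noteq> {}"
  then obtain a b c where abc: "(a, b) \<in> \<sigma>" "(b, c) \<in> \<sigma>"
    by (auto simp: rows_def cols_def)
  have \<sigma>: "\<sigma> \<in> Delta_I TYPE('k) m n" "\<sigma> \<subseteq> grid m n" "\<sigma> \<subseteq> grid m n - {(k, k) | k. k \<in> {1..m}}"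
    using assms by (auto simp: Delta_def)
  then have neq: "a \<noteq> b" "b \<noteq> c"
    using abc by (auto simp: grid_def)
  \<comment> \<open>The smallest variable involved is \<open>(b, b)\<close>, unless
    \<open>(a, c)\<close> is diagonal too; then it is the diagonal one with the larger index,
    because the diagonal variables decrease downwards.\<close>
  define d where "d = (if a = c then max a b else b)"
  have "degrevlex_less var_smaller
      (Poly_Mapping.single (a, c) 1 + Poly_Mapping.single (b, b) 1)
      (Poly_Mapping.single (a, b) 1 + Poly_Mapping.single (b, c) 1)"
  proof (rule degrevlex_less_pairI[where x = "(d, d)"])
    fix y assume "var_smaller y (d, d)"
    then show "y \<notin> {(a, b), (b, c), (a, c), (b, b)}"
      using neq by (cases y) (auto simp: d_def split: if_splits)
  qed (use neq in \<open>auto simp: d_def lookup_add lookup_single when_def max_def\<close>)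
  then show False
    using not_in_Delta_I[OF \<sigma>(2) abc, where 'k = 'k] neq \<sigma>(1) by simp
qed

lemma Delta_southeast_chain:
  assumes "\<sigma> \<in> Delta TYPE('k::field) m n"
  shows "southeast_chain \<sigma>"
proof (rule ccontr)
  assume "\<not> southeast_chain \<sigma>"
  then obtain i j k l where ijkl: "(i, j) \<in> \<sigma>" "(k, l) \<in> \<sigma>" "i < k" "l < j"
    by (auto simp: southeast_chain_def not_le)
  have \<sigma>: "\<sigma> \<in> Delta_I TYPE('k) m n" "\<sigma> \<subseteq> grid m n"
    using assms by (auto simp: Delta_def)
  have "i \<in> rows \<sigma>" "k \<in> rows \<sigma>" "j \<in> cols \<sigma>" "l \<in> cols \<sigma>"
    using ijkl by (force simp: rows_def cols_def)+
  with Delta_rows_cols_disjoint[OF assms] have neq: "i \<noteq> j" "i \<noteq> l" "k \<noteq> j" "k \<noteq> l"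
    by auto
  \<comment> \<open>All four positions are off the diagonal, so the smallest of their variables is
    the last one row by row, the lower right corner \<open>(k, j)\<close>.\<close>
  have "degrevlex_less var_smaller
      (Poly_Mapping.single (i, l) 1 + Poly_Mapping.single (k, j) 1)
      (Poly_Mapping.single (i, j) 1 + Poly_Mapping.single (k, l) 1)"
    by (rule degrevlex_less_pairI[where x = "(k, j)"])
      (use neq ijkl(3,4) in \<open>auto simp: lookup_add lookup_single when_def\<close>)
  then show False
    using not_in_Delta_I[OF \<sigma>(2) ijkl(1,2), where 'k = 'k] ijkl(3,4) \<sigma>(1) by simp
qed

lemma sum_eq_obtain_less:
  fixes f g :: "'a \<Rightarrow> nat"
  assumes "finite A" "sum f A = sum g A" "x \<in> A" "g x < f x"
  obtains y where "y \<in> A" "f y < g y"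
  using assms sum_strict_mono_ex1[of A g f] by (metis less_irrefl not_less)

text \<open>The forward direction collects the two preceding lemmas. Conversely, a monomial in the
  initial ideal is not the smallest of its fibre, and a smaller one would produce two vertices of
  \<sigma> on an antidiagonal.\<close>

lemma Delta_iff:
  shows "\<sigma> \<in> Delta TYPE('k::field) m n \<longleftrightarrow>
    \<sigma> \<subseteq> grid m n \<and> rows \<sigma> \<inter> cols \<sigma> = {} \<and> southeast_chain \<sigma>"
proof safe
  assume "\<sigma> \<in> Delta TYPE('k) m n"
  then show "x \<in> grid m n" if "x \<in> \<sigma>" for x
    using that by (auto simp: Delta_def)
next
  fix x assume "\<sigma> \<in> Delta TYPE('k) m n" "x \<in> rows \<sigma>" "x \<in> cols \<sigma>"
  then show "x \<in> {}"
    using Delta_rows_cols_disjoint by blast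
next
  assume "\<sigma> \<in> Delta TYPE('k) m n"
  then show "southeast_chain \<sigma>"
    by (rule Delta_southeast_chain)
next
  assume \<sigma>: "\<sigma> \<subseteq> grid m n" "rows \<sigma> \<inter> cols \<sigma> = {}" "southeast_chain \<sigma>"
  have fin: "finite \<sigma>"
    using \<sigma>(1) finite_grid by (rule finite_subset)
  let ?u = "\<Sum>x\<in>\<sigma>. Poly_Mapping.single x (1::nat)"
  have u: "Poly_Mapping.lookup ?u y = (if y \<in> \<sigma> then 1 else 0)" for y
    by (rule lookup_sum_single[OF fin])
  have "(\<Prod>x\<in>\<sigma>. var x) \<notin> (in_2minors m n :: (nat \<times> nat, 'k) mpoly set)"
  proof
    assume "(\<Prod>x\<in>\<sigma>. var x) \<in> (in_2minors m n :: (nat \<times> nat, 'k) mpoly set)"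
    from in_2minors_keys_not_minimal[OF this, of ?u] obtain v
      where v: "Poly_Mapping.keys v \<subseteq> grid m n" "same_margins m n v ?u"
        "degrevlex_less var_smaller v ?u"
      by (auto simp: prod_var[OF fin] term_poly_def)
    have "Poly_Mapping.keys ?u \<subseteq> grid m n"
      using \<sigma>(1) by (auto simp: in_keys_iff u simp del: One_nat_def split: if_splits)
    with v obtain k l where kl:
        "Poly_Mapping.lookup v (k, l) > Poly_Mapping.lookup ?u (k, l)"
        "\<And>y. var_smaller y (k, l) \<Longrightarrow> Poly_Mapping.lookup v y = Poly_Mapping.lookup ?u y"
      using same_margins_mono_deg[OF v(2,1)] by (force simp: degrevlex_less_def)
    have in_grid: "k \<in> {1..m}" "l \<in> {1..n}"
      using kl(1) subsetD[OF v(1), of "(k, l)"] by (auto simp: grid_def in_keys_iff)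
    \<comment> \<open>Row \<open>k\<close> and column \<open>l\<close> have the same sums in both
      monomials, so the excess of \<open>v\<close> at \<open>(k, l)\<close> is balanced by deficits
      elsewhere in that row and that column.\<close>
    obtain l' where l': "l' \<in> {1..n}" "Poly_Mapping.lookup v (k, l') < Poly_Mapping.lookup ?u (k, l')"
      using v(2) kl(1) in_grid unfolding same_margins_def
      by (elim conjE) (rule sum_eq_obtain_less[of "{1..n}"
            "\<lambda>j. Poly_Mapping.lookup v (k, j)" "\<lambda>j. Poly_Mapping.lookup ?u (k, j)" l]; simp)
    obtain k' where k': "k' \<in> {1..m}" "Poly_Mapping.lookup v (k', l) < Poly_Mapping.lookup ?u (k', l)"
      using v(2) kl(1) in_grid unfolding same_margins_def
      by (elim conjE) (rule sum_eq_obtain_less[of "{1..m}"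
            "\<lambda>i. Poly_Mapping.lookup v (i, l)" "\<lambda>i. Poly_Mapping.lookup ?u (i, l)" k]; simp)
    have mem: "(k, l') \<in> \<sigma>" "(k', l) \<in> \<sigma>"
      using l'(2) k'(2) by (auto simp: u simp del: One_nat_def split: if_splits)
    then have "k \<in> rows \<sigma>" "k' \<in> rows \<sigma>" "l \<in> cols \<sigma>" "l' \<in> cols \<sigma>"
      by (force simp: rows_def cols_def)+
    with \<sigma>(2) have neq: "k \<noteq> l" "k \<noteq> l'" "k' \<noteq> l"
      by auto
    \<comment> \<open>Variables smaller than the deciding one carry equal exponents, so both
      deficits occur at larger variables. Off the diagonal this means further left and further up,
      which contradicts the chain condition.\<close>
    have "\<not> var_smaller (k, l') (k, l)" "\<not> var_smaller (k', l) (k, l)"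
      using kl(2) l'(2) k'(2) by (metis less_irrefl)+
    then have "l' < l" "k' < k"
      using neq kl(1) l'(2) k'(2) by (auto simp: not_less le_less)
    with \<sigma>(3) mem show False
      by (force simp: southeast_chain_def)
  qed
  moreover have "\<sigma> \<subseteq> grid m n - {(k, k) | k. k \<in> {1..m}}"
    using \<sigma>(1,2) by (force simp: rows_def cols_def)
  ultimately show "\<sigma> \<in> Delta TYPE('k) m n"
    using \<sigma>(1) by (simp add: Delta_def Delta_I_def)
qed

section \<open>The order on the facets\<close>

text \<open>The lexicographic order of increasing enumerations, read off at the least element
  \<open>z\<close> of the symmetric difference: either \<open>B\<close> continues with a larger
  entry in place of \<open>z\<close>, or \<open>A\<close> ends before \<open>z\<close> and is a
  proper prefix.\<close>

definition increasing_less :: "nat set \<Rightarrow> nat set \<Rightarrow> bool" where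
  "increasing_less A B \<longleftrightarrow>
     (\<exists>z\<in>A - B. (\<forall>y<z. y \<in> A \<longleftrightarrow> y \<in> B) \<and> (\<exists>b\<in>B. z < b)) \<or>
     (\<exists>z\<in>B - A. (\<forall>y<z. y \<in> A \<longleftrightarrow> y \<in> B) \<and> (\<forall>a\<in>A. a < z))"

text \<open>The least element of the symmetric difference is determined by the two sets, and the
  conditions imposed at it by the two directions exclude each other.\<close>

lemma increasing_less_asym: "increasing_less A B \<Longrightarrow> \<not> increasing_less B A"
proof
  have unique: "z = z'" if "z \<in> A - B \<or> z \<in> B - A" "\<forall>y<z. y \<in> A \<longleftrightarrow> y \<in> B"
    "z' \<in> A - B \<or> z' \<in> B - A" "\<forall>y<z'. y \<in> A \<longleftrightarrow> y \<in> B" for z z'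
    using that by (metis Diff_iff linorder_neqE_nat)
  assume AB: "increasing_less A B" and BA: "increasing_less B A"
  from AB obtain z where z: "z \<in> A - B \<or> z \<in> B - A" "\<forall>y<z. y \<in> A \<longleftrightarrow> y \<in> B"
    "z \<in> A - B \<Longrightarrow> \<exists>b\<in>B. z < b" "z \<in> B - A \<Longrightarrow> \<forall>a\<in>A. a < z"
    unfolding increasing_less_def by blast
  from BA obtain z' where z': "z' \<in> A - B \<or> z' \<in> B - A" "\<forall>y<z'. y \<in> A \<longleftrightarrow> y \<in> B"
    "z' \<in> B - A \<Longrightarrow> \<exists>a\<in>A. z' < a" "z' \<in> A - B \<Longrightarrow> \<forall>b\<in>B. b < z'"
    unfolding increasing_less_def by blast
  have "z = z'"
    using unique z(1,2) z'(1,2) by blast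
  with z z' show False
    by (meson less_asym)
qed

lemma rows_less_imp_increasing_less:
  assumes "finite A" "finite B" "rows_less A B"
  shows "increasing_less A B"
proof -
  define xs ys where "xs = sorted_list_of_set A" and "ys = sorted_list_of_set B"
  have xs: "set xs = A" "sorted_wrt (<) xs" and ys: "set ys = B" "sorted_wrt (<) ys"
    using assms(1,2) by (simp_all add: xs_def ys_def)
  have "(xs, ys) \<in> lexord {(a, b). a < b}"
    using assms(3) by (simp add: rows_less_def xs_def ys_def)
  then consider (prefix) a v where "ys = xs @ a # v"
    | (differ) u a b v w where "a < b" "xs = u @ a # v" "ys = u @ b # w"
    by (auto simp: lexord_def)
  then show ?thesis
  proof cases
    case prefix
    have "a \<in> B - A" "\<forall>y<a. y \<in> A \<longleftrightarrow> y \<in> B" "\<forall>y\<in>A. y < a"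
      using xs ys unfolding prefix by (auto simp: sorted_wrt_append)
    then show ?thesis
      unfolding increasing_less_def by blast
  next
    case differ
    have "a \<in> A - B" "\<forall>y<a. y \<in> A \<longleftrightarrow> y \<in> B" "b \<in> B"
      using xs ys differ(1) unfolding differ(2,3) by (auto simp: sorted_wrt_append)
    with differ(1) show ?thesis
      unfolding increasing_less_def by blast
  qed
qed

lemma sorted_list_of_set_eq_iff:
  "finite A \<Longrightarrow> finite B \<Longrightarrow> sorted_list_of_set A = sorted_list_of_set B \<longleftrightarrow> A = (B :: nat set)"
  by (metis set_sorted_list_of_set)

lemma rows_less_linear:
  assumes "finite A" "finite B"
  shows "rows_less A B \<or> A = B \<or> rows_less B A"
  using lexord_linear[of "{(a, b). a < (b::nat)}" "sorted_list_of_set A" "sorted_list_of_set B"]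
    sorted_list_of_set_eq_iff[OF assms] unfolding rows_less_def
  by (simp add: less_linear)

text \<open>Only one implication is read off the lists; the other follows from totality of
  \<open>rows_less\<close> and asymmetry of \<open>increasing_less\<close>.\<close>

lemma rows_less_iff:
  assumes "finite A" "finite B"
  shows "rows_less A B \<longleftrightarrow> increasing_less A B"
proof
  assume "increasing_less A B"
  then have "\<not> increasing_less B A" "A \<noteq> B"
    using increasing_less_asym by (blast, metis)
  then show "rows_less A B"
    using rows_less_linear[OF assms] rows_less_imp_increasing_less[OF assms(2,1)] by blast
qed (rule rows_less_imp_increasing_less[OF assms])

lemma rows_less_irrefl: "\<not> rows_less A A"
  unfolding rows_less_def by (rule lexord_irreflexive) simp

lemma rows_less_trans: "rows_less A B \<Longrightarrow> rows_less B C \<Longrightarrow> rows_less A C"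
  unfolding rows_less_def by (rule lexord_trans) (auto intro: transI)

text \<open>A new largest element extends the enumeration, which makes it larger; an element
  inserted before another one lowers an entry (\<open>rows_insert_less\<close>). These two rules
  give the direction of horizontal and vertical exchanges.\<close>

lemma rows_less_insert:
  assumes "finite A" "x \<notin> A" "\<And>a. a \<in> A \<Longrightarrow> a < x"
  shows "rows_less A (insert x A)"
  using assms by (auto simp: rows_less_iff increasing_less_def)

lemma rows_insert_less:
  assumes "finite A" "x \<notin> A" "a \<in> A" "x < a"
  shows "rows_less (insert x A) A"
  using assms by (auto simp: rows_less_iff increasing_less_def)

section \<open>The reading order of positions\<close>

definition reading_less :: "nat \<times> nat \<Rightarrow> nat \<times> nat \<Rightarrow> bool" where
  "reading_less v w \<longleftrightarrow> fst v < fst w \<or> fst v = fst w \<and> snd v < snd w"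

text \<open>For paths with equal row sets this is the order of the paths
  (\<open>facet_less_iff\<close>); in this form it is transitive and total on arbitrary sets of
  positions.\<close>

definition lex_before :: "(nat \<times> nat) set \<Rightarrow> (nat \<times> nat) set \<Rightarrow> bool" where
  "lex_before F G \<longleftrightarrow> (\<exists>z\<in>F - G. \<forall>y. reading_less y z \<longrightarrow> (y \<in> F \<longleftrightarrow> y \<in> G))"

lemma reading_less_linear: "reading_less v w \<or> v = w \<or> reading_less w v"
  by (cases v; cases w) (auto simp: reading_less_def)

lemma reading_less_trans: "reading_less u v \<Longrightarrow> reading_less v w \<Longrightarrow> reading_less u w"
  by (auto simp: reading_less_def)

lemma wf_reading_less: "wf {(v, w). reading_less v w}"
proof -
  have "{(v, w). reading_less v w} = less_than <*lex*> less_than"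
    by (auto simp: reading_less_def)
  then show ?thesis
    by (simp add: wf_lex_prod)
qed

lemma lex_before_irrefl: "\<not> lex_before F F"
  by (simp add: lex_before_def)

lemma lex_before_trans:
  assumes "lex_before F G" "lex_before G H"
  shows "lex_before F H"
proof -
  obtain x where x: "x \<in> F - G" "\<And>v. reading_less v x \<Longrightarrow> v \<in> F \<longleftrightarrow> v \<in> G"
    using assms(1) unfolding lex_before_def by blast
  obtain y where y: "y \<in> G - H" "\<And>v. reading_less v y \<Longrightarrow> v \<in> G \<longleftrightarrow> v \<in> H"
    using assms(2) unfolding lex_before_def by blast
  consider "reading_less x y" | "reading_less y x"
    using reading_less_linear[of x y] x(1) y(1) by blast
  then show ?thesis
  proof cases
    case 1
    then have "x \<in> F - H"
      using x(1) y(2) by blast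
    moreover have "v \<in> F \<longleftrightarrow> v \<in> H" if "reading_less v x" for v
      using x(2)[OF that] y(2)[OF reading_less_trans[OF that 1]] by simp
    ultimately show ?thesis
      unfolding lex_before_def by blast
  next
    case 2
    then have "y \<in> F - H"
      using y(1) x(2) by blast
    moreover have "v \<in> F \<longleftrightarrow> v \<in> H" if "reading_less v y" for v
      using y(2)[OF that] x(2)[OF reading_less_trans[OF that 2]] by simp
    ultimately show ?thesis
      unfolding lex_before_def by blast
  qed
qed

lemma lex_before_linear: "lex_before F G \<or> F = G \<or> lex_before G F"
proof (cases "F = G")
  case False
  then obtain x where "x \<in> (F - G) \<union> (G - F)"
    by blast
  with wf_reading_less obtain z where "z \<in> (F - G) \<union> (G - F)"
    "\<And>y. (y, z) \<in> {(v, w). reading_less v w} \<Longrightarrow> y \<notin> (F - G) \<union> (G - F)"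
    by (rule wfE_min) blast
  then show ?thesis
    unfolding lex_before_def by blast
qed simp

section \<open>Facets as lattice paths\<close>

text \<open>The right-hand side of \<open>Delta_iff\<close>, which is independent of the coefficient
  field.\<close>

definition is_face :: "nat \<Rightarrow> nat \<Rightarrow> (nat \<times> nat) set \<Rightarrow> bool" where
  "is_face m n \<sigma> \<longleftrightarrow> \<sigma> \<subseteq> grid m n \<and> rows \<sigma> \<inter> cols \<sigma> = {} \<and> southeast_chain \<sigma>"

lemma Delta_eq: "Delta TYPE('k::field) m n = {\<sigma>. is_face m n \<sigma>}"
  by (auto simp: Delta_iff is_face_def)

lemma rowsI: "(i, j) \<in> \<sigma> \<Longrightarrow> i \<in> rows \<sigma>"
  and colsI: "(i, j) \<in> \<sigma> \<Longrightarrow> j \<in> cols \<sigma>"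
  by (force simp: rows_def cols_def)+

lemma rowsE:
  assumes "i \<in> rows \<sigma>"
  obtains j where "(i, j) \<in> \<sigma>"
  using assms by (force simp: rows_def)

lemma colsE:
  assumes "j \<in> cols \<sigma>"
  obtains i where "(i, j) \<in> \<sigma>"
  using assms by (force simp: cols_def)

lemma rows_insert [simp]: "rows (insert (i, j) \<sigma>) = insert i (rows \<sigma>)"
  and cols_insert [simp]: "cols (insert (i, j) \<sigma>) = insert j (cols \<sigma>)"
  by (simp_all add: rows_def cols_def)

lemma southeast_chainD:
  "southeast_chain \<sigma> \<Longrightarrow> (i, j) \<in> \<sigma> \<Longrightarrow> (k, l) \<in> \<sigma> \<Longrightarrow> (i \<le> k \<and> j \<le> l) \<or> (k \<le> i \<and> l \<le> j)"
  unfolding southeast_chain_def by (metis linorder_neqE_nat nat_le_linear less_imp_le_nat)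

lemma southeast_chain_insert:
  assumes "southeast_chain \<sigma>" "\<And>i j. (i, j) \<in> \<sigma> \<Longrightarrow> (i \<le> p \<and> j \<le> q) \<or> (p \<le> i \<and> q \<le> j)"
  shows "southeast_chain (insert (p, q) \<sigma>)"
  using assms unfolding southeast_chain_def by fastforce

lemma southeast_chain_subset: "southeast_chain \<tau> \<Longrightarrow> \<sigma> \<subseteq> \<tau> \<Longrightarrow> southeast_chain \<sigma>"
  unfolding southeast_chain_def by blast

lemma southeast_chain_swap: "southeast_chain \<sigma> \<Longrightarrow> southeast_chain (prod.swap ` \<sigma>)"
  unfolding southeast_chain_def by (auto simp: not_less[symmetric])

lemma southeast_chain_insert_col:
  assumes "southeast_chain \<sigma>" "finite \<sigma>" "\<sigma> \<noteq> {}" "x \<notin> cols \<sigma>"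
  shows "\<exists>p\<in>rows \<sigma>. southeast_chain (insert (p, x) \<sigma>)"
proof -
  let ?A = "rows {v \<in> \<sigma>. snd v < x}"
  have fin: "finite (rows \<sigma>)" "finite ?A"
    using assms(2) by (simp_all add: rows_def)
  have sub: "?A \<subseteq> rows \<sigma>"
    by (auto simp: rows_def)
  \<comment> \<open>The lowest row met to the left of column \<open>x\<close>. If nothing lies
    there, the top row is taken, and the new vertex precedes the whole chain.\<close>
  define p where "p = (if ?A = {} then Min (rows \<sigma>) else Max ?A)"
  have p: "p \<in> rows \<sigma>"
  proof (cases "?A = {}")
    case True
    then show ?thesis
      using fin(1) assms(3) Min_in[of "rows \<sigma>"] by (auto simp: p_def rows_def[of \<sigma>])
  next
    case False
    then show ?thesis
      using Max_in[OF fin(2)] sub unfolding p_def by auto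
  qed
  moreover have "(i \<le> p \<and> j \<le> x) \<or> (p \<le> i \<and> x \<le> j)" if ij: "(i, j) \<in> \<sigma>" for i j
  proof (cases "j < x")
    case True
    then have "i \<in> ?A"
      using ij by (force simp: rows_def)
    with True show ?thesis
      using fin by (auto simp: p_def)
  next
    case False
    have "p \<le> i"
    proof (cases "?A = {}")
      case True
      then show ?thesis
        using fin rowsI[OF ij] by (auto simp: p_def)
    next
      case False
      then have "p \<in> ?A"
        using fin Max_in[of ?A] by (simp add: p_def)
      then obtain l where "(p, l) \<in> \<sigma>" "l < x"
        by (auto simp: rows_def)
      with \<open>\<not> j < x\<close> show ?thesis
        using southeast_chainD[OF assms(1) ij, of p l] by auto
    qed
    with False show ?thesis
      by simp
  qed
  ultimately show ?thesis
    using southeast_chain_insert[OF assms(1)] by blast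
qed

text \<open>Transposition reduces this to inserting a column.\<close>

lemma southeast_chain_insert_row:
  assumes "southeast_chain \<sigma>" "finite \<sigma>" "\<sigma> \<noteq> {}" "x \<notin> rows \<sigma>"
  shows "\<exists>q\<in>cols \<sigma>. southeast_chain (insert (x, q) \<sigma>)"
proof -
  have "rows (prod.swap ` \<sigma>) = cols \<sigma>" "cols (prod.swap ` \<sigma>) = rows \<sigma>"
    by (auto simp: rows_def cols_def image_image)
  then obtain q where q: "q \<in> cols \<sigma>" "southeast_chain (insert (q, x) (prod.swap ` \<sigma>))"
    using southeast_chain_insert_col[of "prod.swap ` \<sigma>" x] assms southeast_chain_swap by auto
  from southeast_chain_swap[OF q(2)] q(1) show ?thesis
    by (auto simp: image_image)
qed

lemma is_face_finite: "is_face m n \<sigma> \<Longrightarrow> finite \<sigma>"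
  unfolding is_face_def using finite_grid finite_subset by blast

lemma is_face_subset:
  assumes "is_face m n \<tau>" "\<sigma> \<subseteq> \<tau>" shows "is_face m n \<sigma>"
proof -
  have "rows \<sigma> \<subseteq> rows \<tau>" "cols \<sigma> \<subseteq> cols \<tau>"
    using assms(2) by (auto simp: rows_def cols_def)
  then show ?thesis
    using assms southeast_chain_subset unfolding is_face_def by blast
qed

text \<open>The new vertex lies in a row already present, so \<open>x\<close> is the only new index
  and rows stay disjoint from columns.\<close>

lemma is_face_insert_col:
  assumes "is_face m n \<sigma>" "\<sigma> \<noteq> {}" "x \<in> {1..n}" "x \<notin> rows \<sigma>" "x \<notin> cols \<sigma>"
  shows "\<exists>p\<in>rows \<sigma>. is_face m n (insert (p, x) \<sigma>)"
proof -
  obtain p where p: "p \<in> rows \<sigma>" "southeast_chain (insert (p, x) \<sigma>)"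
    using southeast_chain_insert_col[OF _ is_face_finite[OF assms(1)] assms(2,5)] assms(1)
    by (auto simp: is_face_def)
  then have "p \<in> {1..m}"
    using assms(1) by (auto simp: is_face_def grid_def rows_def)
  with p assms show ?thesis
    by (auto simp: is_face_def grid_def intro!: bexI[of _ p])
qed

lemma is_face_insert_row:
  assumes "is_face m n \<sigma>" "\<sigma> \<noteq> {}" "x \<in> {1..m}" "x \<notin> rows \<sigma>" "x \<notin> cols \<sigma>"
  shows "\<exists>q\<in>cols \<sigma>. is_face m n (insert (x, q) \<sigma>)"
proof -
  obtain q where q: "q \<in> cols \<sigma>" "southeast_chain (insert (x, q) \<sigma>)"
    using southeast_chain_insert_row[OF _ is_face_finite[OF assms(1)] assms(2,4)] assms(1)
    by (auto simp: is_face_def)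
  then have "q \<in> {1..n}"
    using assms(1) by (auto simp: is_face_def grid_def cols_def)
  with q assms show ?thesis
    by (auto simp: is_face_def grid_def intro!: bexI[of _ q])
qed

section \<open>Indices, steps and length of maximal faces\<close>

locale facet =
  fixes m n :: nat and F :: "(nat \<times> nat) set"
  assumes two_le_m: "2 \<le> m" and m_less_n: "m < n"
    and face: "is_face m n F"
    and maximal: "\<And>G. is_face m n G \<Longrightarrow> F \<subseteq> G \<Longrightarrow> G = F"

lemma facet_iff:
  "2 \<le> m \<Longrightarrow> m < n \<Longrightarrow> F \<in> facets {\<sigma>. is_face m n \<sigma>} \<longleftrightarrow> facet m n F"
  by (auto simp: facets_def facet_def)

context facet
begin

lemma finite_F: "finite F"
  using face by (rule is_face_finite)

lemma finite_rows [simp]: "finite (rows F)" and finite_cols [simp]: "finite (cols F)"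
  using finite_F by (simp_all add: rows_def cols_def)

lemma chain: "(i, j) \<in> F \<Longrightarrow> (k, l) \<in> F \<Longrightarrow> (i \<le> k \<and> j \<le> l) \<or> (k \<le> i \<and> l \<le> j)"
  using face southeast_chainD unfolding is_face_def by blast

lemma disjoint: "x \<in> rows F \<Longrightarrow> x \<notin> cols F"
  using face unfolding is_face_def by blast

lemma rows_le: "rows F \<subseteq> {1..m}" and cols_le: "cols F \<subseteq> {1..n}"
  using face by (auto simp: is_face_def grid_def rows_def cols_def)

lemma nonempty: "F \<noteq> {}"
proof
  assume "F = {}"
  moreover have "is_face m n {(1, 2)}"
    using two_le_m m_less_n
    by (auto simp: is_face_def grid_def rows_def cols_def southeast_chain_def)
  ultimately show False
    using maximal by blast
qed

lemma rows_nonempty [simp]: "rows F \<noteq> {}" and cols_nonempty [simp]: "cols F \<noteq> {}"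
  using nonempty by (simp_all add: rows_def cols_def)

text \<open>Inserting such a position gives a face again, so by maximality it is already
  there.\<close>

lemma mem_if_comparable:
  assumes "p \<in> rows F" "q \<in> cols F"
    and "\<And>i j. (i, j) \<in> F \<Longrightarrow> (i \<le> p \<and> j \<le> q) \<or> (p \<le> i \<and> q \<le> j)"
  shows "(p, q) \<in> F"
proof -
  have "(p, q) \<in> grid m n"
    using assms(1,2) rows_le cols_le by (auto simp: grid_def)
  moreover have "southeast_chain (insert (p, q) F)"
    using face southeast_chain_insert assms(3) by (auto simp: is_face_def)
  ultimately have "is_face m n (insert (p, q) F)"
    using face assms(1,2) by (simp add: is_face_def insert_absorb)
  then show ?thesis
    using maximal by blast
qed

text \<open>An index that is neither a row nor a column could be inserted as a column, against
  maximality.\<close>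

lemma rows_Un_cols: "rows F \<union> cols F = {1..n}"
proof
  show "rows F \<union> cols F \<subseteq> {1..n}"
    using rows_le cols_le m_less_n by (auto simp: subset_iff)
  show "{1..n} \<subseteq> rows F \<union> cols F"
  proof
    fix x assume x: "x \<in> {1..n}"
    show "x \<in> rows F \<union> cols F"
    proof (rule ccontr)
      assume nx: "x \<notin> rows F \<union> cols F"
      then obtain p where "is_face m n (insert (p, x) F)"
        using is_face_insert_col[OF face nonempty x] by auto
      then have "(p, x) \<in> F"
        using maximal by blast
      with nx show False
        using colsI by blast
    qed
  qed
qed

lemma col_if_not_row:
  assumes "1 \<le> x" "x \<le> n" "x \<notin> rows F"
  shows "x \<in> cols F"
proof -
  have "x \<in> rows F \<union> cols F"
    unfolding rows_Un_cols using assms(1,2) by simp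
  with assms(3) show ?thesis
    by simp
qed

lemma n_in_cols: "n \<in> cols F"
proof (rule col_if_not_row)
  show "n \<notin> rows F"
    using subsetD[OF rows_le, of n] m_less_n by auto
qed (use two_le_m m_less_n in linarith)+

text \<open>The nearest vertex in the direction considered lies in the next column (or row): a
  vertex strictly between would be forced into the same line by comparability with both ends. This
  lemma and the next three free turns from \<open>consecutive_in\<close>.\<close>

lemma ex_step_right: "(i, j) \<in> F \<Longrightarrow> (\<exists>w. step_right F (i, j) w) \<longleftrightarrow> (\<exists>l>j. (i, l) \<in> F)"
proof
  assume ij: "(i, j) \<in> F" and "\<exists>l>j. (i, l) \<in> F"
  then have "{l. (i, l) \<in> F \<and> j < l} \<noteq> {}"
    by blast
  moreover have "finite {l. (i, l) \<in> F \<and> j < l}"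
    by (rule finite_subset[OF _ finite_cols]) (auto intro: colsI)
  ultimately obtain l where l: "(i, l) \<in> F" "j < l" "\<And>c. (i, c) \<in> F \<Longrightarrow> j < c \<Longrightarrow> l \<le> c"
    using Min_in[of "{l. (i, l) \<in> F \<and> j < l}"] Min_le[of "{l. (i, l) \<in> F \<and> j < l}"] by auto
  have "consecutive_in (cols F) j l"
  proof -
    have "\<not> (j < c \<and> c < l)" if "c \<in> cols F" for c
    proof
      assume c: "j < c \<and> c < l"
      from that obtain p where p: "(p, c) \<in> F"
        by (rule colsE)
      have "p = i"
        using chain[OF ij p] chain[OF l(1) p] c by auto
      with l(3)[of c] p c show False by simp
    qed
    then show ?thesis
      using ij l colsI by (auto simp: consecutive_in_def)
  qed
  then show "\<exists>w. step_right F (i, j) w"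
    using ij l(1) by (auto simp: step_right_def intro!: exI[of _ "(i, l)"])
qed (auto simp: step_right_def consecutive_in_def)

lemma ex_step_right_rev: "(i, j) \<in> F \<Longrightarrow> (\<exists>u. step_right F u (i, j)) \<longleftrightarrow> (\<exists>l<j. (i, l) \<in> F)"
proof
  assume ij: "(i, j) \<in> F" and "\<exists>l<j. (i, l) \<in> F"
  then have "{l. (i, l) \<in> F \<and> l < j} \<noteq> {}"
    by blast
  moreover have "finite {l. (i, l) \<in> F \<and> l < j}"
    by (rule finite_subset[OF _ finite_cols]) (auto intro: colsI)
  ultimately obtain l where l: "(i, l) \<in> F" "l < j" "\<And>c. (i, c) \<in> F \<Longrightarrow> c < j \<Longrightarrow> c \<le> l"
    using Max_in[of "{l. (i, l) \<in> F \<and> l < j}"] Max_ge[of "{l. (i, l) \<in> F \<and> l < j}"] by auto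
  have "consecutive_in (cols F) l j"
  proof -
    have "\<not> (l < c \<and> c < j)" if "c \<in> cols F" for c
    proof
      assume c: "l < c \<and> c < j"
      from that obtain p where p: "(p, c) \<in> F"
        by (rule colsE)
      have "p = i"
        using chain[OF ij p] chain[OF l(1) p] c by auto
      with l(3)[of c] p c show False by simp
    qed
    then show ?thesis
      using ij l colsI by (auto simp: consecutive_in_def)
  qed
  then show "\<exists>u. step_right F u (i, j)"
    using ij l(1) by (auto simp: step_right_def intro!: exI[of _ "(i, l)"])
qed (auto simp: step_right_def consecutive_in_def)

lemma ex_step_down: "(i, j) \<in> F \<Longrightarrow> (\<exists>w. step_down F (i, j) w) \<longleftrightarrow> (\<exists>k>i. (k, j) \<in> F)"
proof
  assume ij: "(i, j) \<in> F" and "\<exists>k>i. (k, j) \<in> F"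
  then have "{k. (k, j) \<in> F \<and> i < k} \<noteq> {}"
    by blast
  moreover have "finite {k. (k, j) \<in> F \<and> i < k}"
    by (rule finite_subset[OF _ finite_rows]) (auto intro: rowsI)
  ultimately obtain k where k: "(k, j) \<in> F" "i < k" "\<And>c. (c, j) \<in> F \<Longrightarrow> i < c \<Longrightarrow> k \<le> c"
    using Min_in[of "{k. (k, j) \<in> F \<and> i < k}"] Min_le[of "{k. (k, j) \<in> F \<and> i < k}"] by auto
  have "consecutive_in (rows F) i k"
  proof -
    have "\<not> (i < c \<and> c < k)" if "c \<in> rows F" for c
    proof
      assume c: "i < c \<and> c < k"
      from that obtain q where q: "(c, q) \<in> F"
        by (rule rowsE)
      have "q = j"
        using chain[OF ij q] chain[OF k(1) q] c by auto
      with k(3)[of c] q c show False by simp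
    qed
    then show ?thesis
      using ij k rowsI by (auto simp: consecutive_in_def)
  qed
  then show "\<exists>w. step_down F (i, j) w"
    using ij k(1) by (auto simp: step_down_def intro!: exI[of _ "(k, j)"])
qed (auto simp: step_down_def consecutive_in_def)

lemma ex_step_down_rev: "(i, j) \<in> F \<Longrightarrow> (\<exists>u. step_down F u (i, j)) \<longleftrightarrow> (\<exists>k<i. (k, j) \<in> F)"
proof
  assume ij: "(i, j) \<in> F" and "\<exists>k<i. (k, j) \<in> F"
  then have "{k. (k, j) \<in> F \<and> k < i} \<noteq> {}"
    by blast
  moreover have "finite {k. (k, j) \<in> F \<and> k < i}"
    by (rule finite_subset[OF _ finite_rows]) (auto intro: rowsI)
  ultimately obtain k where k: "(k, j) \<in> F" "k < i" "\<And>c. (c, j) \<in> F \<Longrightarrow> c < i \<Longrightarrow> c \<le> k"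
    using Max_in[of "{k. (k, j) \<in> F \<and> k < i}"] Max_ge[of "{k. (k, j) \<in> F \<and> k < i}"] by auto
  have "consecutive_in (rows F) k i"
  proof -
    have "\<not> (k < c \<and> c < i)" if "c \<in> rows F" for c
    proof
      assume c: "k < c \<and> c < i"
      from that obtain q where q: "(c, q) \<in> F"
        by (rule rowsE)
      have "q = j"
        using chain[OF ij q] chain[OF k(1) q] c by auto
      with k(3)[of c] q c show False by simp
    qed
    then show ?thesis
      using ij k rowsI by (auto simp: consecutive_in_def)
  qed
  then show "\<exists>u. step_down F u (i, j)"
    using ij k(1) by (auto simp: step_down_def intro!: exI[of _ "(k, j)"])
qed (auto simp: step_down_def consecutive_in_def)

lemma right_turning_iff:
  "(i, j) \<in> F \<Longrightarrow> right_turning F (i, j) \<longleftrightarrow> (\<exists>l<j. (i, l) \<in> F) \<and> (\<exists>k>i. (k, j) \<in> F)"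
  unfolding right_turning_def by (simp only: ex_step_right_rev ex_step_down)

lemma left_turning_iff:
  "(i, j) \<in> F \<Longrightarrow> left_turning F (i, j) \<longleftrightarrow> (\<exists>k<i. (k, j) \<in> F) \<and> (\<exists>l>j. (i, l) \<in> F)"
  unfolding left_turning_def by (simp only: ex_step_down_rev ex_step_right)

text \<open>If the path stopped here, all later vertices would lie in rows below \<open>i\<close>.
  With \<open>k'\<close> the first of these rows, \<open>(k', j)\<close> is comparable with every
  vertex and hence a vertex itself, a contradiction.\<close>

lemma next_vertex:
  assumes "(i, j) \<in> F" "(k, l) \<in> F" "i < k \<or> j < l"
  shows "(\<exists>l>j. (i, l) \<in> F) \<or> (\<exists>k>i. (k, j) \<in> F)"
proof (rule ccontr)
  assume none: "\<not> ?thesis"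
  let ?A = "{v \<in> F. i < fst v \<or> j < snd v}"
  define k' where "k' = Min (rows ?A)"
  have A: "finite (rows ?A)" "rows ?A \<noteq> {}"
    using finite_F assms(2,3) by (force simp: rows_def)+
  have strict: "i < a" if "a \<in> rows ?A" for a
    using that
  proof (rule rowsE)
    fix b assume "(a, b) \<in> ?A"
    then show "i < a"
      using none chain[OF assms(1), of a b] by (cases "a = i") auto
  qed
  have k': "k' \<in> rows ?A" "\<And>a. a \<in> rows ?A \<Longrightarrow> k' \<le> a"
    unfolding k'_def using A by simp_all
  have "(k', j) \<in> F"
  proof (rule mem_if_comparable)
    show "k' \<in> rows F" "j \<in> cols F"
      using k'(1) assms(1) colsI by (auto simp: rows_def)
    fix a b assume ab: "(a, b) \<in> F"
    show "(a \<le> k' \<and> b \<le> j) \<or> (k' \<le> a \<and> j \<le> b)"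
    proof (cases "(a, b) \<in> ?A")
      case True
      then show ?thesis
        using k'(2) rowsI[of a b ?A] chain[OF assms(1) ab] by auto
    next
      case False
      then show ?thesis
        using ab strict[OF k'(1)] by auto
    qed
  qed
  with none strict[OF k'(1)] show False
    by blast
qed

text \<open>The mirror image of \<open>next_vertex\<close>, with the last row of the earlier
  vertices as \<open>k'\<close>.\<close>

lemma previous_vertex:
  assumes "(i, j) \<in> F" "(k, l) \<in> F" "k < i \<or> l < j"
  shows "(\<exists>l<j. (i, l) \<in> F) \<or> (\<exists>k<i. (k, j) \<in> F)"
proof (rule ccontr)
  assume none: "\<not> ?thesis"
  let ?A = "{v \<in> F. fst v < i \<or> snd v < j}"
  define k' where "k' = Max (rows ?A)"
  have A: "finite (rows ?A)" "rows ?A \<noteq> {}"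
    using finite_F assms(2,3) by (force simp: rows_def)+
  have strict: "a < i" if "a \<in> rows ?A" for a
    using that
  proof (rule rowsE)
    fix b assume "(a, b) \<in> ?A"
    then show "a < i"
      using none chain[OF assms(1), of a b] by (cases "a = i") auto
  qed
  have k': "k' \<in> rows ?A" "\<And>a. a \<in> rows ?A \<Longrightarrow> a \<le> k'"
    unfolding k'_def using A by simp_all
  have "(k', j) \<in> F"
  proof (rule mem_if_comparable)
    show "k' \<in> rows F" "j \<in> cols F"
      using k'(1) assms(1) colsI by (auto simp: rows_def)
    fix a b assume ab: "(a, b) \<in> F"
    show "(a \<le> k' \<and> b \<le> j) \<or> (k' \<le> a \<and> j \<le> b)"
    proof (cases "(a, b) \<in> ?A")
      case True
      then show ?thesis
        using k'(2) rowsI[of a b ?A] chain[OF assms(1) ab] by auto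
    next
      case False
      then show ?thesis
        using ab strict[OF k'(1)] by auto
    qed
  qed
  with none strict[OF k'(1)] show False
    by blast
qed

lemma first_vertex: "(Min (rows F), Min (cols F)) \<in> F"
proof (rule mem_if_comparable)
  show "(i \<le> Min (rows F) \<and> j \<le> Min (cols F)) \<or> (Min (rows F) \<le> i \<and> Min (cols F) \<le> j)"
    if "(i, j) \<in> F" for i j
    using rowsI[OF that] colsI[OF that] by simp
qed simp_all

text \<open>Every vertex but the first enters a new row or a new column; recording it enumerates all
  indices but those of the first row and column.\<close>

lemma card_eq: "card F = n - 1"
proof -
  define a b where "a = Min (rows F)" and "b = Min (cols F)"
  have ab: "(a, b) \<in> F" "a \<in> rows F" "b \<in> cols F"
    "\<And>i. i \<in> rows F \<Longrightarrow> a \<le> i" "\<And>j. j \<in> cols F \<Longrightarrow> b \<le> j"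
    using first_vertex by (simp_all add: a_def b_def)
  let ?L = "\<lambda>i j. \<exists>l<j. (i, l) \<in> F"
  let ?U = "\<lambda>i j. \<exists>k<i. (k, j) \<in> F"
  define f where "f = (\<lambda>(i, j). if ?L i j then j else i)"
  have entered: "?L i j \<or> ?U i j" if "(i, j) \<in> F - {(a, b)}" for i j
    using that previous_vertex[of i j a b] ab(1) ab(4)[OF rowsI[of i j F]] ab(5)[OF colsI[of i j F]]
    by (cases "i = a") auto
  \<comment> \<open>A vertex to the left in the row and one above in the column would be
    incomparable.\<close>
  have not_both: "\<not> (?L i j \<and> ?U i j)" for i j
    using chain by (metis leD)
  have "bij_betw f (F - {(a, b)}) ({1..n} - {a, b})"
  proof (rule bij_betw_imageI)
    show "inj_on f (F - {(a, b)})"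
    proof (rule inj_onI)
      fix v w assume vw: "v \<in> F - {(a, b)}" "w \<in> F - {(a, b)}" "f v = f w"
      obtain i j k l where v: "v = (i, j)" and w: "w = (k, l)"
        by (cases v, cases w)
      with vw have ij: "(i, j) \<in> F" and kl: "(k, l) \<in> F" and eq: "f (i, j) = f (k, l)"
        by simp_all
      have mem: "i \<in> rows F" "j \<in> cols F" "k \<in> rows F" "l \<in> cols F"
        using ij kl rowsI colsI by blast+
      show "v = w"
      proof (cases "?L i j")
        case True
        with eq have "?L k l" "j = l"
          using disjoint mem by (auto simp: f_def split: if_splits)
        \<comment> \<open>Of two vertices in one column, the lower one would be entered both from
          the left and from above.\<close>
        moreover have "\<not> i < k" "\<not> k < i"
          using True \<open>?L k l\<close> \<open>j = l\<close> not_both[where i = i and j = j] not_both[where i = k and j = l]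
            ij kl by blast+
        ultimately show ?thesis
          by (simp add: v w)
      next
        case False
        with eq have "\<not> ?L k l" "i = k"
          using disjoint mem by (auto simp: f_def split: if_splits)
        moreover have "\<not> j < l" "\<not> l < j"
          using False \<open>\<not> ?L k l\<close> \<open>i = k\<close> ij kl by blast+
        ultimately show ?thesis
          by (simp add: v w)
      qed
    qed
    show "f ` (F - {(a, b)}) = {1..n} - {a, b}"
    proof
      show "f ` (F - {(a, b)}) \<subseteq> {1..n} - {a, b}"
      proof (rule image_subsetI)
        fix v assume "v \<in> F - {(a, b)}"
        moreover obtain i j where v: "v = (i, j)"
          by (cases v)
        ultimately have ij: "(i, j) \<in> F - {(a, b)}"
          by simp
        then have mem: "i \<in> rows F" "j \<in> cols F"
          using rowsI colsI by blast+
        show "f v \<in> {1..n} - {a, b}"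
        proof (cases "?L i j")
          case True
          then have "b < j"
            using ab(5) colsI by (meson le_less_trans)
          with True mem show ?thesis
            using disjoint ab(2) cols_le by (auto simp: f_def v)
        next
          case False
          with ij entered[of i j] have "?U i j"
            by blast
          then have "a < i"
            using ab(4) rowsI by (meson le_less_trans)
          with False mem show ?thesis
            using disjoint ab(3) rows_Un_cols by (auto simp: f_def v)
        qed
      qed
      show "{1..n} - {a, b} \<subseteq> f ` (F - {(a, b)})"
      proof
        fix x assume x: "x \<in> {1..n} - {a, b}"
        then consider "x \<in> cols F" | "x \<in> rows F"
          using rows_Un_cols by blast
        then show "x \<in> f ` (F - {(a, b)})"
        proof cases
          case 1
          then obtain i0 where i0: "(i0, x) \<in> F"
            by (rule colsE)
          \<comment> \<open>The top vertex of column \<open>x\<close> has nothing above it, so it is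
            entered from the left and \<open>f\<close> records \<open>x\<close> there.\<close>
          define i where "i = (LEAST i. (i, x) \<in> F)"
          have i: "(i, x) \<in> F" "\<not> ?U i x"
            unfolding i_def using i0 by (auto intro: LeastI dest: not_less_Least)
          moreover have "(i, x) \<in> F - {(a, b)}"
            using i x by auto
          ultimately have "f (i, x) = x"
            using entered[of i x] by (auto simp: f_def)
          with \<open>(i, x) \<in> F - {(a, b)}\<close> show ?thesis
            by force
        next
          case 2
          then obtain j0 where j0: "(x, j0) \<in> F"
            by (rule rowsE)
          define j where "j = (LEAST j. (x, j) \<in> F)"
          have j: "(x, j) \<in> F" "\<not> ?L x j"
            unfolding j_def using j0 by (auto intro: LeastI dest: not_less_Least)
          then have "(x, j) \<in> F - {(a, b)}" "f (x, j) = x"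
            using x by (auto simp: f_def)
          then show ?thesis
            by force
        qed
      qed
    qed
  qed
  then have "card (F - {(a, b)}) = card ({1..n} - {a, b})"
    by (rule bij_betw_same_card)
  \<comment> \<open>Rows and columns are disjoint, so exactly two indices are left out.\<close>
  moreover have "a \<noteq> b" "a \<in> {1..n}" "b \<in> {1..n}"
    using ab(2,3) disjoint rows_Un_cols by auto
  then have "card ({1..n} - {a, b}) = n - 2"
    by (simp add: card_Diff_subset)
  ultimately show ?thesis
    using ab(1) finite_F two_le_m m_less_n by (simp add: card_Diff_singleton)
qed

end

section \<open>Exchange of a single vertex\<close>

text \<open>Some maximal face contains \<sigma> and has equally many vertices. This turns the
  maximality of an exchanged face into a count.\<close>

lemma facet_if_card:
  assumes "2 \<le> m" "m < n" "is_face m n \<sigma>" "card \<sigma> = n - 1"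
  shows "facet m n \<sigma>"
proof (rule facet.intro)
  fix G assume G: "is_face m n G" "\<sigma> \<subseteq> G"
  have "{\<sigma>. is_face m n \<sigma>} \<subseteq> Pow (grid m n)"
    by (auto simp: is_face_def)
  then have "finite {\<sigma>. is_face m n \<sigma>}"
    by (rule finite_subset) simp
  then obtain H where H: "is_face m n H" "G \<subseteq> H" "\<And>H'. is_face m n H' \<Longrightarrow> H \<subseteq> H' \<Longrightarrow> H' = H"
    using finite_has_maximal2[of "{\<sigma>. is_face m n \<sigma>}" G] G(1) by auto
  then have "facet m n H"
    using assms(1,2) by (intro facet.intro) auto
  have "\<sigma> = H"
    using G(2) H(2) assms(4) facet.card_eq[OF \<open>facet m n H\<close>]
    by (intro card_subset_eq[OF facet.finite_F[OF \<open>facet m n H\<close>]]) auto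
  with G(2) H(2) show "G = \<sigma>"
    by blast
qed (use assms in auto)

lemma consecutive_in_unique: "consecutive_in A a b \<Longrightarrow> consecutive_in A a c \<Longrightarrow> b = c"
  by (auto simp: consecutive_in_def intro: linorder_cases[of b c])

lemma rows_Diff:
  assumes "(i, l) \<in> F" "l \<noteq> j"
  shows "rows (F - {(i, j)}) = rows F"
proof
  show "rows F \<subseteq> rows (F - {(i, j)})"
  proof
    fix p assume "p \<in> rows F"
    then obtain q where "(p, q) \<in> F"
      by (rule rowsE)
    then show "p \<in> rows (F - {(i, j)})"
      using assms rowsI[of p q "F - {(i, j)}"] rowsI[of i l "F - {(i, j)}"] by (cases "p = i") auto
  qed
qed (auto simp: rows_def)

context facet
begin

lemma le_Max_rows: "i \<in> rows F \<Longrightarrow> i \<le> Max (rows F)"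
  and Max_rows_mem: "Max (rows F) \<in> rows F"
  using Max_ge[OF finite_rows] Max_in[OF finite_rows rows_nonempty] by blast+

lemma Max_rows_le: "Max (rows F) \<le> m"
  using Max_rows_mem rows_le by (meson atLeastAtMost_iff subsetD)

lemma cols_eq: "cols F = {1..n} - rows F"
  using rows_Un_cols disjoint by blast

lemma horizontal_iff: "horizontal F (i, j) \<longleftrightarrow> (i, j) \<in> F \<and> (\<forall>k. (k, j) \<in> F \<longrightarrow> k = i)"
  by (auto simp: horizontal_def)

lemma vertical_iff: "vertical F (i, j) \<longleftrightarrow> (i, j) \<in> F \<and> (\<forall>l. (i, l) \<in> F \<longrightarrow> l = j)"
  by (auto simp: vertical_def)

lemma exchange_facet:
  assumes "v \<in> F" "w \<notin> F" "is_face m n (insert w (F - {v}))"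
  shows "facet m n (insert w (F - {v}))"
proof (rule facet_if_card[OF two_le_m m_less_n assms(3)])
  show "card (insert w (F - {v})) = n - 1"
    using assms(1,2) finite_F card_eq two_le_m m_less_n by (simp add: card_Diff_singleton)
qed

lemma is_face_insert_comparable:
  assumes "p \<in> rows F" "q \<in> cols F" "\<sigma> \<subseteq> F"
    and "\<And>i j. (i, j) \<in> \<sigma> \<Longrightarrow> (i \<le> p \<and> j \<le> q) \<or> (p \<le> i \<and> q \<le> j)"
  shows "is_face m n (insert (p, q) \<sigma>)"
proof -
  have "is_face m n \<sigma>"
    using face assms(3) by (rule is_face_subset)
  moreover have "rows \<sigma> \<subseteq> rows F" "cols \<sigma> \<subseteq> cols F"
    using assms(3) by (auto simp: rows_def cols_def)
  moreover have "(p, q) \<in> grid m n"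
    using assms(1,2) rows_le cols_le by (auto simp: grid_def)
  ultimately show ?thesis
    using southeast_chain_insert[OF _ assms(4)] disjoint assms(1,2)
    by (auto simp: is_face_def)
qed

lemma two_le_card: "2 \<le> card F"
  using card_eq two_le_m m_less_n by simp

text \<open>There are at least two vertices, so the path continues from or arrives at
  \<open>(i, j)\<close>. In particular no vertex is both horizontal and vertical.\<close>

lemma not_isolated:
  assumes "(i, j) \<in> F"
  shows "(\<exists>k. k \<noteq> i \<and> (k, j) \<in> F) \<or> (\<exists>l. l \<noteq> j \<and> (i, l) \<in> F)"
proof -
  have "F \<noteq> {(i, j)}"
    using two_le_card by auto
  with assms obtain k l where kl: "(k, l) \<in> F" "(k, l) \<noteq> (i, j)"
    by auto
  then consider "i < k \<or> j < l" | "k < i \<or> l < j"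
    by fastforce
  then show ?thesis
    using next_vertex[OF assms kl(1)] previous_vertex[OF assms kl(1)] by cases (metis less_irrefl)+
qed

text \<open>The corner is flipped to the opposite corner \<open>(i', j')\<close> of its unit square,
  which lies in an earlier row and therefore comes first in reading order.\<close>

lemma left_turning_exchange:
  assumes "left_turning F v"
  shows "\<exists>G. facet m n G \<and> rows G = rows F \<and> lex_before G F \<and> F - {v} \<subseteq> G"
proof -
  obtain u t where steps: "step_down F u v" "step_right F v t"
    using assms by (auto simp: left_turning_def)
  obtain i j where v: "v = (i, j)"
    by (cases v)
  obtain i' where u: "u = (i', j)"
    using steps(1) v by (cases u) (auto simp: step_down_def)
  obtain j' where t: "t = (i, j')"
    using steps(2) v by (cases t) (auto simp: step_right_def)
  have mem: "(i, j) \<in> F" "(i', j) \<in> F" "(i, j') \<in> F"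
    and cons: "consecutive_in (rows F) i' i" "consecutive_in (cols F) j j'"
    using steps unfolding u v t by (auto simp: step_down_def step_right_def)
  have lt: "i' < i" "j < j'"
    using cons by (auto simp: consecutive_in_def)
  have w: "(i', j') \<notin> F"
    using chain[OF mem(1), of i' j'] lt by auto
  let ?G = "insert (i', j') (F - {v})"
  have "is_face m n ?G"
  proof (rule is_face_insert_comparable)
    fix p q assume pq: "(p, q) \<in> F - {v}"
    \<comment> \<open>Nothing lies strictly between consecutive rows or columns, so the only vertex
      incomparable with the new corner is the removed one.\<close>
    have "\<not> (i' < p \<and> p < i)" "\<not> (j < q \<and> q < j')"
      using pq cons rowsI[of p q F] colsI[of p q F] by (auto simp: consecutive_in_def)
    moreover have "(p, q) \<noteq> (i, j)"
      using pq v by blast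
    ultimately show "(p \<le> i' \<and> q \<le> j') \<or> (i' \<le> p \<and> j' \<le> q)"
      using chain[OF mem(1), of p q] chain[OF mem(2), of p q] chain[OF mem(3), of p q] pq lt
      by auto
  qed (use mem rowsI colsI in blast)+
  then have "facet m n ?G"
    using exchange_facet mem(1) w v by blast
  moreover have "rows ?G = rows F"
    using rows_Diff[OF mem(3)] rowsI[OF mem(2)] lt by (simp add: v insert_absorb)
  moreover have "lex_before ?G F"
    unfolding lex_before_def using w lt by (intro bexI[of _ "(i', j')"]) (auto simp: reading_less_def v)
  ultimately show ?thesis
    by blast
qed

lemma right_turning_exchange:
  assumes "right_turning F v"
  shows "\<exists>G. facet m n G \<and> rows G = rows F \<and> lex_before F G \<and> F - {v} \<subseteq> G"
proof -
  obtain u t where steps: "step_right F u v" "step_down F v t"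
    using assms by (auto simp: right_turning_def)
  obtain i j where v: "v = (i, j)"
    by (cases v)
  obtain j' where u: "u = (i, j')"
    using steps(1) v by (cases u) (auto simp: step_right_def)
  obtain i' where t: "t = (i', j)"
    using steps(2) v by (cases t) (auto simp: step_down_def)
  have mem: "(i, j) \<in> F" "(i', j) \<in> F" "(i, j') \<in> F"
    and cons: "consecutive_in (rows F) i i'" "consecutive_in (cols F) j' j"
    using steps unfolding u v t by (auto simp: step_down_def step_right_def)
  have lt: "i < i'" "j' < j"
    using cons by (auto simp: consecutive_in_def)
  have w: "(i', j') \<notin> F"
    using chain[OF mem(1), of i' j'] lt by auto
  let ?G = "insert (i', j') (F - {v})"
  have "is_face m n ?G"
  proof (rule is_face_insert_comparable)
    fix p q assume pq: "(p, q) \<in> F - {v}"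
    have "\<not> (i < p \<and> p < i')" "\<not> (j' < q \<and> q < j)"
      using pq cons rowsI[of p q F] colsI[of p q F] by (auto simp: consecutive_in_def)
    moreover have "(p, q) \<noteq> (i, j)"
      using pq v by blast
    ultimately show "(p \<le> i' \<and> q \<le> j') \<or> (i' \<le> p \<and> j' \<le> q)"
      using chain[OF mem(1), of p q] chain[OF mem(2), of p q] chain[OF mem(3), of p q] pq lt
      by auto
  qed (use mem rowsI colsI in blast)+
  then have "facet m n ?G"
    using exchange_facet mem(1) w v by blast
  moreover have "rows ?G = rows F"
    using rows_Diff[OF mem(3)] rowsI[OF mem(2)] lt by (simp add: v insert_absorb)
  moreover have "lex_before F ?G"
    unfolding lex_before_def using mem lt by (intro bexI[of _ v]) (auto simp: reading_less_def v)
  ultimately show ?thesis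
    by blast
qed

text \<open>A horizontal vertex is alone in its column but not in its row. Its removal frees the
  index \<open>j\<close> and keeps all rows; \<open>j\<close> then enters as a row, which requires
  \<open>j \<le> m\<close>.\<close>

lemma horizontal_exchange:
  assumes "horizontal F (i, j)" "j \<le> m"
  shows "\<exists>G. facet m n G \<and> rows G = insert j (rows F) \<and> F - {(i, j)} \<subseteq> G"
proof -
  let ?\<sigma> = "F - {(i, j)}"
  have ij: "(i, j) \<in> F" "\<And>k. (k, j) \<in> F \<Longrightarrow> k = i"
    using assms(1) by (auto simp: horizontal_iff)
  then obtain l where l: "l \<noteq> j" "(i, l) \<in> F"
    using not_isolated by blast
  have rows: "rows ?\<sigma> = rows F"
    using l(2,1) by (rule rows_Diff)
  have j: "j \<notin> rows F" "j \<in> {1..m}"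
    using colsI[OF ij(1)] disjoint cols_le assms(2) by auto
  have "j \<notin> cols ?\<sigma>"
    using ij(2) by (auto simp: cols_def)
  then obtain q where "is_face m n (insert (j, q) ?\<sigma>)"
    using is_face_insert_row[OF is_face_subset[OF face], of ?\<sigma> j] j l rows by blast
  moreover have "(j, q) \<notin> F"
    using j(1) rowsI by blast
  ultimately have "facet m n (insert (j, q) ?\<sigma>)"
    using exchange_facet ij(1) by blast
  moreover have "rows (insert (j, q) ?\<sigma>) = insert j (rows F)"
    by (simp add: rows)
  ultimately show ?thesis
    by blast
qed

text \<open>The removal frees the row index \<open>i\<close>, which can always return as a column
  because every row index is at most \<open>n\<close>.\<close>

lemma vertical_exchange:
  assumes "vertical F (i, j)"
  shows "\<exists>G. facet m n G \<and> rows G = rows F - {i} \<and> F - {(i, j)} \<subseteq> G"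
proof -
  let ?\<sigma> = "F - {(i, j)}"
  have ij: "(i, j) \<in> F" "\<And>l. (i, l) \<in> F \<Longrightarrow> l = j"
    using assms(1) by (auto simp: vertical_iff)
  have "?\<sigma> \<noteq> {}"
    using not_isolated[OF ij(1)] by blast
  have rows: "rows ?\<sigma> = rows F - {i}"
    using ij(2) by (force simp: rows_def)
  have i: "i \<notin> cols F" "i \<in> {1..n}"
    using rowsI[OF ij(1)] disjoint rows_Un_cols by auto
  then have "i \<notin> cols ?\<sigma>"
    by (auto simp: cols_def)
  then obtain p where "is_face m n (insert (p, i) ?\<sigma>)" "p \<in> rows ?\<sigma>"
    using is_face_insert_col[OF is_face_subset[OF face], of ?\<sigma> i] i \<open>?\<sigma> \<noteq> {}\<close> rows by blast
  moreover have "(p, i) \<notin> F"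
    using i(1) colsI by blast
  ultimately have "facet m n (insert (p, i) ?\<sigma>)" "rows (insert (p, i) ?\<sigma>) = rows F - {i}"
    using exchange_facet ij(1) by (auto simp: rows)
  then show ?thesis
    by blast
qed

section \<open>Rows and columns that meet \<open>F_minus\<close> or \<open>F_plus\<close>\<close>

text \<open>At its lowest vertex in column \<open>a\<close> the path turns right, because it must
  still reach column \<open>n\<close>. That vertex is alone in its column or a left turn.\<close>

lemma col_meets_F_minus:
  assumes "a \<in> cols F" "a < Max (rows F)"
  shows "\<exists>i. (i, a) \<in> F_minus F"
proof -
  have "finite {i. (i, a) \<in> F}"
    by (rule finite_subset[OF _ finite_rows]) (auto intro: rowsI)
  moreover have "{i. (i, a) \<in> F} \<noteq> {}"
    using assms(1) by (auto elim: colsE)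
  ultimately obtain i where i: "(i, a) \<in> F" "\<And>k. (k, a) \<in> F \<Longrightarrow> k \<le> i"
    using Max_in[of "{i. (i, a) \<in> F}"] Max_ge[of "{i. (i, a) \<in> F}"] by auto
  have "a < n"
    using assms(2) m_less_n Max_rows_le by linarith
  obtain p where "(p, n) \<in> F"
    using n_in_cols by (rule colsE)
  then have right: "\<exists>l>a. (i, l) \<in> F"
    using next_vertex[OF i(1)] i(2) \<open>a < n\<close> by (meson leD)
  have "(i, a) \<in> F_minus F"
  proof (cases "horizontal F (i, a)")
    case True
    then show ?thesis
      using i(1) assms(2) by (simp add: F_minus_def)
  next
    case False
    then obtain k where "(k, a) \<in> F" "k \<noteq> i"
      using i(1) by (auto simp: horizontal_iff)
    then have "left_turning F (i, a)"
      using right i by (auto simp: left_turning_iff le_less)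
    then show ?thesis
      using i(1) by (simp add: F_minus_def)
  qed
  then show ?thesis
    by blast
qed

text \<open>The leftmost vertex of the last row is entered from above, since an earlier row exists.
  It is alone in its row or a left turn.\<close>

lemma last_row_meets_F_minus:
  assumes "k \<in> rows F" "k < Max (rows F)"
  shows "\<exists>j. (Max (rows F), j) \<in> F_minus F"
proof -
  define i where "i = Max (rows F)"
  have "i \<in> rows F"
    unfolding i_def by (rule Max_rows_mem)
  then obtain j0 where j0: "(i, j0) \<in> F"
    by (rule rowsE)
  define j where "j = (LEAST j. (i, j) \<in> F)"
  have j: "(i, j) \<in> F" "\<And>l. (i, l) \<in> F \<Longrightarrow> j \<le> l"
    unfolding j_def using j0 by (auto intro: LeastI Least_le)
  obtain l where "(k, l) \<in> F"
    using assms(1) by (rule rowsE)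
  then have up: "\<exists>k<i. (k, j) \<in> F"
    using previous_vertex[OF j(1)] j(2) assms(2) by (metis i_def leD)
  have "(i, j) \<in> F_minus F"
  proof (cases "vertical F (i, j)")
    case True
    then show ?thesis
      using j(1) by (simp add: F_minus_def i_def)
  next
    case False
    then obtain l where "(i, l) \<in> F" "l \<noteq> j"
      using j(1) by (auto simp: vertical_iff)
    then have "left_turning F (i, j)"
      using up j by (auto simp: left_turning_iff le_less)
    then show ?thesis
      using j(1) by (simp add: F_minus_def)
  qed
  then show ?thesis
    unfolding i_def by blast
qed

text \<open>The rightmost vertex of a row before the last one is left downwards. It is alone in its
  row or a right turn.\<close>

lemma row_meets_F_plus:
  assumes "a \<in> rows F" "a < Max (rows F)"
  shows "\<exists>j. (a, j) \<in> F_plus m F"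
proof -
  have "finite {j. (a, j) \<in> F}"
    by (rule finite_subset[OF _ finite_cols]) (auto intro: colsI)
  moreover have "{j. (a, j) \<in> F} \<noteq> {}"
    using assms(1) by (auto elim: rowsE)
  ultimately obtain j where j: "(a, j) \<in> F" "\<And>l. (a, l) \<in> F \<Longrightarrow> l \<le> j"
    using Max_in[of "{j. (a, j) \<in> F}"] Max_ge[of "{j. (a, j) \<in> F}"] by auto
  obtain q where "(Max (rows F), q) \<in> F"
    using Max_rows_mem by (rule rowsE)
  then have down: "\<exists>k>a. (k, j) \<in> F"
    using next_vertex[OF j(1)] j(2) assms(2) by (meson leD)
  have "(a, j) \<in> F_plus m F"
  proof (cases "vertical F (a, j)")
    case True
    then show ?thesis
      using j(1) assms(2) by (simp add: F_plus_def)
  next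
    case False
    then obtain l where "(a, l) \<in> F" "l \<noteq> j"
      using j(1) by (auto simp: vertical_iff)
    then have "right_turning F (a, j)"
      using down j(1) j(2)[OF \<open>(a, l) \<in> F\<close>] by (auto simp: right_turning_iff le_less)
    then show ?thesis
      using j(1) by (simp add: F_plus_def)
  qed
  then show ?thesis
    by blast
qed

text \<open>If the column is the first one, its top vertex need not be a turn; it is then vertical.\<close>

lemma col_meets_F_plus:
  assumes "b \<in> cols F" "Max (rows F) < b" "b \<le> m"
  shows "\<exists>i. (i, b) \<in> F_plus m F"
proof -
  obtain i0 where i0: "(i0, b) \<in> F"
    using assms(1) by (rule colsE)
  define i where "i = (LEAST i. (i, b) \<in> F)"
  have i: "(i, b) \<in> F" "\<And>k. (k, b) \<in> F \<Longrightarrow> i \<le> k"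
    unfolding i_def using i0 by (auto intro: LeastI Least_le)
  have "(i, b) \<in> F_plus m F"
  proof (cases "horizontal F (i, b)")
    case True
    then show ?thesis
      using i(1) assms(2,3) by (simp add: F_plus_def)
  next
    case False
    then obtain k where "(k, b) \<in> F" "k \<noteq> i"
      using i(1) by (auto simp: horizontal_iff)
    with i(2)[of k] have k: "(k, b) \<in> F" "i < k"
      by simp_all
    show ?thesis
    proof (cases "\<exists>l<b. (i, l) \<in> F")
      case True
      then have "right_turning F (i, b)"
        using i(1) k by (auto simp: right_turning_iff)
      then show ?thesis
        using i(1) by (simp add: F_plus_def)
    next
      case False
      \<comment> \<open>The path goes down from here, so nothing lies to the right either.\<close>
      have "l = b" if "(i, l) \<in> F" for l
      proof -
        have "\<not> l < b"
          using False that by blast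
        with chain[OF k(1) that] k(2) show ?thesis
          by simp
      qed
      then have "vertical F (i, b)"
        using i(1) unfolding vertical_iff by blast
      moreover have "i < Max (rows F)"
        using k(2) le_Max_rows[OF rowsI[OF k(1)]] by simp
      ultimately show ?thesis
        using i(1) by (simp add: F_plus_def)
    qed
  qed
  then show ?thesis
    by blast
qed

end

section \<open>The facet order in terms of reading order\<close>

text \<open>After the common initial part, the step to the right in \<open>F\<close> is the first
  difference in reading order. Conversely, the predecessor in \<open>F\<close> of the first
  difference is the point where the paths separate.\<close>

lemma facet_less_iff:
  assumes F: "facet m n F" and G: "facet m n G"
  shows "facet_less F G \<longleftrightarrow> rows_less (rows F) (rows G) \<or> rows F = rows G \<and> lex_before F G"
proof -
  have "(\<exists>u. path_upto F u = path_upto G u \<and> (\<exists>v. step_right F u v) \<and> (\<exists>w. step_down G u w)) \<longleftrightarrow>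
      lex_before F G" (is "?P \<longleftrightarrow> _") if rows: "rows F = rows G"
  proof
    have cols: "cols F = cols G"
      using rows by (simp add: facet.cols_eq[OF F] facet.cols_eq[OF G])
    {
      assume ?P
      then obtain u v w where uvw: "path_upto F u = path_upto G u" "step_right F u v" "step_down G u w"
        by blast
      obtain a b where u: "u = (a, b)"
        by (cases u)
      obtain b' where v: "v = (a, b')"
        using uvw(2) u by (cases v) (auto simp: step_right_def)
      obtain a' where w: "w = (a', b)"
        using uvw(3) u by (cases w) (auto simp: step_down_def)
      have mem: "(a, b) \<in> F" "(a, b) \<in> G" "(a, b') \<in> F" "(a', b) \<in> G"
        and cons: "consecutive_in (cols F) b b'" "consecutive_in (rows G) a a'"
        using uvw(2,3) unfolding u v w by (auto simp: step_right_def step_down_def)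
      have lt: "b < b'" "a < a'"
        using cons by (auto simp: consecutive_in_def)
      have "(a, b') \<notin> G"
        using facet.chain[OF G mem(4), of a b'] lt by auto
      moreover have "y \<in> F \<longleftrightarrow> y \<in> G" if y: "reading_less y (a, b')" for y
      proof -
        obtain p q where pq: "y = (p, q)"
          by (cases y)
        \<comment> \<open>Vertices of either path that precede \<open>v\<close> in reading order
          belong to the initial part up to \<open>u\<close>, where the paths agree.\<close>
        have "p \<le> a \<and> q \<le> b" if "y \<in> F \<or> y \<in> G"
        proof -
          have "q \<in> cols F"
            using that colsI cols unfolding pq by blast
          then have "\<not> (b < q \<and> q < b')"
            using cons(1) by (auto simp: consecutive_in_def)
          moreover have "p < a \<or> p = a \<and> q < b'"
            using y by (simp add: pq reading_less_def)
          moreover have "(a \<le> p \<and> b \<le> q) \<or> (p \<le> a \<and> q \<le> b)"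
            using that facet.chain[OF F mem(1)] facet.chain[OF G mem(2)] unfolding pq by blast
          ultimately show ?thesis
            by auto
        qed
        then have "y \<in> F \<longleftrightarrow> y \<in> path_upto F u" "y \<in> G \<longleftrightarrow> y \<in> path_upto G u"
          by (auto simp: path_upto_def u pq)
        then show ?thesis
          using uvw(1) by simp
      qed
      ultimately show "lex_before F G"
        unfolding lex_before_def using mem(3) by blast
    }
    {
      assume "lex_before F G"
      then obtain a l where z: "(a, l) \<in> F" "(a, l) \<notin> G"
        "\<And>y. reading_less y (a, l) \<Longrightarrow> y \<in> F \<longleftrightarrow> y \<in> G"
        unfolding lex_before_def by auto
      \<comment> \<open>Equal rows give equal columns and hence the same first vertex, so the first
        difference has a predecessor in \<open>F\<close>.\<close>
      have "(Min (rows F), Min (cols F)) \<in> G"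
        using facet.first_vertex[OF G] by (simp add: rows cols)
      with z(2) have "(Min (rows F), Min (cols F)) \<noteq> (a, l)"
        by auto
      moreover have "Min (rows F) \<le> a" "Min (cols F) \<le> l"
        using rowsI[OF z(1)] colsI[OF z(1)] facet.finite_rows[OF F] facet.finite_cols[OF F] by simp_all
      ultimately have "Min (rows F) < a \<or> Min (cols F) < l"
        by auto
      then consider "\<exists>l'<l. (a, l') \<in> F" | "\<exists>k<a. (k, l) \<in> F"
        using facet.previous_vertex[OF F z(1) facet.first_vertex[OF F]] by blast
      then show ?P
      proof cases
        case 1
        then obtain u where u: "step_right F u (a, l)"
          using facet.ex_step_right_rev[OF F z(1)] by blast
        then obtain l' where l': "u = (a, l')" "consecutive_in (cols F) l' l" "(a, l') \<in> F"
          by (cases u) (auto simp: step_right_def)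
        then have "l' < l"
          by (simp add: consecutive_in_def)
        then have uG: "(a, l') \<in> G"
          using l'(3) z(3)[of "(a, l')"] by (simp add: reading_less_def)
        \<comment> \<open>A step to the right in \<open>G\<close> would end in the next column,
          which is the position \<open>(a, l)\<close> missing from \<open>G\<close>.\<close>
        have not_right: "\<not> (\<exists>q>l'. (a, q) \<in> G)"
        proof
          assume "\<exists>q>l'. (a, q) \<in> G"
          then obtain v where "step_right G (a, l') v"
            using facet.ex_step_right[OF G uG] by blast
          then obtain q where q: "(a, q) \<in> G" "consecutive_in (cols F) l' q"
            by (cases v) (auto simp: step_right_def cols)
          with l'(2) have "q = l"
            using consecutive_in_unique by blast
          with q(1) z(2) show False
            by simp
        qed
        obtain p where "(p, l) \<in> G"
          using colsI[OF z(1)] unfolding cols by (rule colsE)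
        then have "\<exists>k>a. (k, l') \<in> G"
          using facet.next_vertex[OF G uG, of p l] not_right \<open>l' < l\<close> by blast
        then have "\<exists>w. step_down G u w"
          using facet.ex_step_down[OF G uG] l'(1) by blast
        moreover have "path_upto F u = path_upto G u"
        proof -
          have "y \<in> F \<longleftrightarrow> y \<in> G" if "fst y \<le> a" "snd y \<le> l'" for y
            using that \<open>l' < l\<close> by (intro z(3)) (auto simp: reading_less_def)
          then show ?thesis
            unfolding path_upto_def l'(1) by auto
        qed
        ultimately show ?thesis
          using u by blast
      next
        case 2
        then obtain u where u: "step_down F u (a, l)"
          using facet.ex_step_down_rev[OF F z(1)] by blast
        then obtain k where k: "u = (k, l)" "consecutive_in (rows F) k a" "(k, l) \<in> F"
          by (cases u) (auto simp: step_down_def)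
        then have "k < a"
          by (simp add: consecutive_in_def)
        then have uG: "(k, l) \<in> G"
          using k(3) z(3)[of "(k, l)"] by (simp add: reading_less_def)
        obtain q where "(a, q) \<in> G"
          using rowsI[OF z(1)] unfolding rows by (rule rowsE)
        \<comment> \<open>Entering \<open>(a, l)\<close> from above is impossible: a vertex of
          \<open>G\<close> to the right of \<open>(k, l)\<close> would also be in \<open>F\<close>
          and incomparable with \<open>(a, l)\<close>, and a step down in \<open>G\<close> would end
          at \<open>(a, l)\<close>.\<close>
        then consider "\<exists>q>l. (k, q) \<in> G" | "\<exists>p>k. (p, l) \<in> G"
          using facet.next_vertex[OF G uG, of a q] \<open>k < a\<close> by blast
        then show ?thesis
        proof cases
          case 1
          then obtain q where q: "l < q" "(k, q) \<in> G"
            by blast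
          then have "(k, q) \<in> F"
            using z(3)[of "(k, q)"] \<open>k < a\<close> by (simp add: reading_less_def)
          then show ?thesis
            using facet.chain[OF F z(1), of k q] q(1) \<open>k < a\<close> by simp
        next
          case 2
          then obtain w where "step_down G (k, l) w"
            using facet.ex_step_down[OF G uG] by blast
          then obtain p where p: "(p, l) \<in> G" "consecutive_in (rows F) k p"
            by (cases w) (auto simp: step_down_def rows)
          with k(2) have "p = a"
            using consecutive_in_unique by blast
          with p(1) z(2) show ?thesis
            by simp
        qed
      qed
    }
  qed
  then show ?thesis
    unfolding facet_less_def by blast
qed

section \<open>Exchange with and separation from smaller and larger facets\<close>

context facet
begin

text \<open>For horizontal vertices the new row \<open>j\<close> precedes the last row, which lowers
  an entry of the enumeration; for vertical ones the last row is dropped, which leaves a proper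
  prefix.\<close>

lemma F_minus_exchange:
  assumes "v \<in> F_minus F"
  shows "\<exists>G. facet m n G \<and> facet_less G F \<and> F - {v} \<subseteq> G"
proof -
  have less: "facet_less G F"
    if "facet m n G" "rows_less (rows G) (rows F) \<or> rows G = rows F \<and> lex_before G F" for G
    using that facet_less_iff facet_axioms by blast
  obtain i j where v: "v = (i, j)"
    by (cases v)
  from assms consider "left_turning F v"
    | "horizontal F (i, j)" "j < Max (rows F)"
    | "vertical F (i, j)" "i = Max (rows F)"
    by (auto simp: F_minus_def v)
  then show ?thesis
  proof cases
    case 1
    then show ?thesis
      using left_turning_exchange less by blast
  next
    case 2
    have "j \<le> m"
      using Max_rows_le 2(2) by linarith
    then obtain G where G: "facet m n G" "rows G = insert j (rows F)" "F - {v} \<subseteq> G"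
      using horizontal_exchange 2(1) v by blast
    have "(i, j) \<in> F"
      using 2(1) by (simp add: horizontal_iff)
    then have "j \<notin> rows F"
      using colsI disjoint by blast
    then have "rows_less (rows G) (rows F)"
      unfolding G(2) using 2(2) by (intro rows_insert_less[of _ _ "Max (rows F)"]) simp_all
    with G less show ?thesis
      by blast
  next
    case 3
    then obtain G where G: "facet m n G" "rows G = rows F - {i}" "F - {v} \<subseteq> G"
      using vertical_exchange v by blast
    have "i \<in> rows F"
      using 3(2) Max_rows_mem by simp
    moreover have "a < i" if "a \<in> rows F - {i}" for a
      using that 3(2) le_Max_rows[of a] by (simp add: le_less del: Max_ge)
    ultimately have "rows_less (rows G) (rows F)"
      unfolding G(2) using rows_less_insert[of "rows F - {i}" i] by (simp add: insert_absorb)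
    with G less show ?thesis
      by blast
  qed
qed

text \<open>Here a horizontal exchange appends a row after the last one, and a vertical exchange
  drops a row that later rows follow; both make the row set larger.\<close>

lemma F_plus_exchange:
  assumes "v \<in> F_plus m F"
  shows "\<exists>G. facet m n G \<and> facet_less F G \<and> F - {v} \<subseteq> G"
proof -
  have less: "facet_less F G"
    if "facet m n G" "rows_less (rows F) (rows G) \<or> rows F = rows G \<and> lex_before F G" for G
    using that facet_less_iff facet_axioms by blast
  obtain i j where v: "v = (i, j)"
    by (cases v)
  from assms consider "right_turning F v"
    | "horizontal F (i, j)" "Max (rows F) < j" "j \<le> m"
    | "vertical F (i, j)" "i < Max (rows F)"
    by (auto simp: F_plus_def v)
  then show ?thesis
  proof cases
    case 1
    then show ?thesis
      using right_turning_exchange less by metis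
  next
    case 2
    then obtain G where G: "facet m n G" "rows G = insert j (rows F)" "F - {v} \<subseteq> G"
      using horizontal_exchange v by blast
    have "a < j" if "a \<in> rows F" for a
      using that 2(2) le_Max_rows[of a] by simp
    then have "rows_less (rows F) (rows G)"
      unfolding G(2) by (intro rows_less_insert) auto
    with G less show ?thesis
      by blast
  next
    case 3
    then obtain G where G: "facet m n G" "rows G = rows F - {i}" "F - {v} \<subseteq> G"
      using vertical_exchange v by blast
    have "(i, j) \<in> F"
      using 3(1) by (simp add: vertical_iff)
    then have "insert i (rows F - {i}) = rows F"
      using rowsI by blast
    moreover have "Max (rows F) \<in> rows F - {i}"
      using 3(2) by simp
    ultimately have "rows_less (rows F) (rows G)"
      unfolding G(2) using rows_insert_less[of "rows F - {i}" i "Max (rows F)"] 3(2) by simp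
    with G less show ?thesis
      by blast
  qed
qed

text \<open>A row of \<open>G\<close> missing from \<open>F\<close> is a column that
  \<open>G\<close> avoids; if \<open>G\<close> has a proper prefix of the rows, it avoids the last
  row of \<open>F\<close>; with equal rows, \<open>G\<close> avoids the left turn that ends the
  descent of \<open>F\<close> after the separation.\<close>

lemma F_minus_separates:
  assumes G: "facet m n G" and less: "facet_less G F"
  shows "\<exists>v\<in>F_minus F. v \<notin> G"
proof -
  from less consider "increasing_less (rows G) (rows F)"
    | u v w where "rows G = rows F" "step_right G u v" "step_down F u w"
    unfolding facet_less_def by (auto simp: rows_less_iff facet.finite_rows[OF G])
  then show ?thesis
  proof cases
    case 1
    then consider z b where "z \<in> rows G - rows F" "b \<in> rows F" "z < b"
      | z where "z \<in> rows F - rows G" "\<forall>y<z. y \<in> rows G \<longleftrightarrow> y \<in> rows F" "\<forall>a\<in>rows G. a < z"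
      unfolding increasing_less_def by blast
    then show ?thesis
    proof cases
      case 1
      then have "z < Max (rows F)"
        using le_Max_rows by (meson less_le_trans)
      moreover have "z \<in> cols F"
        using 1(1) facet.rows_le[OF G] m_less_n by (intro col_if_not_row) auto
      ultimately obtain i where "(i, z) \<in> F_minus F"
        using col_meets_F_minus by blast
      moreover have "(i, z) \<notin> G"
        using 1(1) facet.disjoint[OF G] colsI by blast
      ultimately show ?thesis
        by blast
    next
      case 2
      have z: "z \<le> Max (rows F)"
        using 2(1) by simp
      \<comment> \<open>Any row of \<open>G\<close> is an earlier row of \<open>F\<close>, so the
        last row of \<open>F\<close> is not its first.\<close>
      obtain a where a: "a \<in> rows G"
        using facet.rows_nonempty[OF G] by blast
      then have "a \<in> rows F" "a < Max (rows F)"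
        using 2(2,3) z by auto
      then obtain j where "(Max (rows F), j) \<in> F_minus F"
        using last_row_meets_F_minus by blast
      moreover have "(Max (rows F), j) \<notin> G"
        using 2(3) z rowsI by (metis leD)
      ultimately show ?thesis
        by blast
    qed
  next
    case 2
    obtain a b where u: "u = (a, b)"
      by (cases u)
    obtain b' where v: "v = (a, b')"
      using 2(2) u by (cases v) (auto simp: step_right_def)
    obtain a' where w: "w = (a', b)"
      using 2(3) u by (cases w) (auto simp: step_down_def)
    have mem: "(a, b) \<in> F" "(a', b) \<in> F" "(a, b') \<in> G" "b < b'" "a < a'"
      using 2(2,3) unfolding u v w by (auto simp: step_right_def step_down_def consecutive_in_def)
    \<comment> \<open>The bottom vertex of the descent, from which \<open>F\<close> must go on to
      column \<open>b'\<close>; it is strictly below and left of \<open>(a, b')\<close>, hence not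
      in \<open>G\<close>.\<close>
    have "finite {k. (k, b) \<in> F}"
      by (rule finite_subset[OF _ finite_rows]) (auto intro: rowsI)
    with mem(2) obtain k where k: "(k, b) \<in> F" "\<And>p. (p, b) \<in> F \<Longrightarrow> p \<le> k"
      using Max_in[of "{k. (k, b) \<in> F}"] Max_ge[of "{k. (k, b) \<in> F}"] by blast
    have "a < k"
      using k(2)[OF mem(2)] mem(5) by simp
    have "b' \<in> cols F"
      using colsI[OF mem(3)] 2(1) by (simp add: cols_eq facet.cols_eq[OF G])
    then obtain p where "(p, b') \<in> F"
      by (rule colsE)
    then have "\<exists>l>b. (k, l) \<in> F"
      using next_vertex[OF k(1)] k(2) mem(4) by (meson leD)
    then have "left_turning F (k, b)"
      using k(1) mem(1) \<open>a < k\<close> by (auto simp: left_turning_iff)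
    then have "(k, b) \<in> F_minus F"
      using k(1) by (simp add: F_minus_def)
    moreover have "(k, b) \<notin> G"
      using facet.chain[OF G mem(3), of k b] mem(4) \<open>a < k\<close> by auto
    ultimately show ?thesis
      by blast
  qed
qed

text \<open>Either \<open>G\<close> omits a row of \<open>F\<close> other than the last, or it has a
  row beyond the last row of \<open>F\<close> and avoids that column, or the row sets agree and
  \<open>G\<close> avoids the right turn of \<open>F\<close> after the separation.\<close>

lemma F_plus_separates:
  assumes G: "facet m n G" and less: "facet_less F G"
  shows "\<exists>v\<in>F_plus m F. v \<notin> G"
proof -
  have new_row: ?thesis if b: "b \<in> rows G" "Max (rows F) < b" for b
  proof -
    have "b \<notin> rows F"
      using b(2) le_Max_rows[of b] by auto
    moreover have "1 \<le> b" "b \<le> m"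
      using b(1) facet.rows_le[OF G] by auto
    ultimately have "b \<in> cols F" "b \<le> m"
      using m_less_n by (auto intro: col_if_not_row)
    then obtain i where "(i, b) \<in> F_plus m F"
      using col_meets_F_plus b(2) by blast
    moreover have "(i, b) \<notin> G"
      using b(1) facet.disjoint[OF G] colsI by blast
    ultimately show ?thesis
      by blast
  qed
  from less consider "increasing_less (rows F) (rows G)"
    | u v w where "rows F = rows G" "step_right F u v" "step_down G u w"
    unfolding facet_less_def by (auto simp: rows_less_iff facet.finite_rows[OF G])
  then show ?thesis
  proof cases
    case 1
    then consider z b where "z \<in> rows F - rows G" "b \<in> rows G" "z < b"
      | z where "z \<in> rows G" "\<forall>a\<in>rows F. a < z"
      unfolding increasing_less_def by blast
    then show ?thesis
    proof cases
      case 1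
      show ?thesis
      proof (cases "z < Max (rows F)")
        case True
        then obtain j where "(z, j) \<in> F_plus m F"
          using row_meets_F_plus 1(1) by blast
        moreover have "(z, j) \<notin> G"
          using 1(1) rowsI by blast
        ultimately show ?thesis
          by blast
      next
        case False
        \<comment> \<open>The omitted row is the last one of \<open>F\<close>, so the larger row
          \<open>b\<close> of \<open>G\<close> lies beyond all rows of \<open>F\<close>.\<close>
        then show ?thesis
          using new_row[OF 1(2)] 1(3) by linarith
      qed
    next
      case 2
      then show ?thesis
        using new_row by simp
    qed
  next
    case 2
    obtain a b where u: "u = (a, b)"
      by (cases u)
    obtain b' where v: "v = (a, b')"
      using 2(2) u by (cases v) (auto simp: step_right_def)
    obtain a' where w: "w = (a', b)"
      using 2(3) u by (cases w) (auto simp: step_down_def)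
    have mem: "(a, b) \<in> F" "(a, b') \<in> F" "(a', b) \<in> G" "b < b'" "a < a'"
      using 2(2,3) unfolding u v w by (auto simp: step_right_def step_down_def consecutive_in_def)
    have "finite {l. (a, l) \<in> F}"
      by (rule finite_subset[OF _ finite_cols]) (auto intro: colsI)
    with mem(2) obtain l where l: "(a, l) \<in> F" "\<And>q. (a, q) \<in> F \<Longrightarrow> q \<le> l"
      using Max_in[of "{l. (a, l) \<in> F}"] Max_ge[of "{l. (a, l) \<in> F}"] by blast
    have "b < l"
      using l(2)[OF mem(2)] mem(4) by simp
    have "a' \<in> rows F"
      using rowsI[OF mem(3)] 2(1) by simp
    then obtain q where "(a', q) \<in> F"
      by (rule rowsE)
    then have "\<exists>k>a. (k, l) \<in> F"
      using next_vertex[OF l(1)] l(2) mem(5) by (meson leD)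
    then have "right_turning F (a, l)"
      using l(1) mem(1) \<open>b < l\<close> by (auto simp: right_turning_iff)
    then have "(a, l) \<in> F_plus m F"
      using l(1) by (simp add: F_plus_def)
    moreover have "(a, l) \<notin> G"
      using facet.chain[OF G mem(3), of a l] mem(5) \<open>b < l\<close> by auto
    ultimately show ?thesis
      by blast
  qed
qed

end

section \<open>The shelling\<close>

lemma facet_less_irrefl: "facet m n F \<Longrightarrow> \<not> facet_less F F"
  by (simp add: facet_less_iff rows_less_irrefl lex_before_irrefl)

lemma facet_less_trans:
  "facet m n F \<Longrightarrow> facet m n G \<Longrightarrow> facet m n H \<Longrightarrow> facet_less F G \<Longrightarrow> facet_less G H \<Longrightarrow> facet_less F H"
  unfolding facet_less_iff using rows_less_trans lex_before_trans by metis

lemma facet_less_linear: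
  assumes "facet m n F" "facet m n G"
  shows "facet_less F G \<or> F = G \<or> facet_less G F"
proof -
  have "finite (rows F)" "finite (rows G)"
    using assms facet.finite_rows by blast+
  then show ?thesis
    unfolding facet_less_iff[OF assms] facet_less_iff[OF assms(2,1)]
    using rows_less_linear lex_before_linear by metis
qed

text \<open>The second assumption puts each intersection of \<open>F\<close> with a member of
  \<open>\<G>\<close> into some \<open>F - {v}\<close>, and the first puts each
  \<open>F - {v}\<close> into a member. It serves both directions of the shelling.\<close>

lemma intersection_generated_complex:
  assumes "\<And>v. v \<in> A \<Longrightarrow> \<exists>G\<in>\<G>. F - {v} \<subseteq> G" and "\<And>G. G \<in> \<G> \<Longrightarrow> \<exists>v\<in>A. v \<notin> G"
  shows "generated_complex {F} \<inter> generated_complex \<G> = generated_complex {F - {v} | v. v \<in> A}"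
proof
  show "generated_complex {F} \<inter> generated_complex \<G> \<subseteq> generated_complex {F - {v} | v. v \<in> A}"
  proof
    fix \<sigma> assume "\<sigma> \<in> generated_complex {F} \<inter> generated_complex \<G>"
    then obtain G where G: "\<sigma> \<subseteq> F" "G \<in> \<G>" "\<sigma> \<subseteq> G"
      by (auto simp: generated_complex_def)
    then obtain v where "v \<in> A" "v \<notin> G"
      using assms(2) by blast
    with G show "\<sigma> \<in> generated_complex {F - {v} | v. v \<in> A}"
      by (auto simp: generated_complex_def)
  qed
  show "generated_complex {F - {v} | v. v \<in> A} \<subseteq> generated_complex {F} \<inter> generated_complex \<G>"
  proof
    fix \<sigma> assume "\<sigma> \<in> generated_complex {F - {v} | v. v \<in> A}"
    then obtain v where v: "v \<in> A" "\<sigma> \<subseteq> F - {v}"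
      by (auto simp: generated_complex_def)
    then obtain G where "G \<in> \<G>" "\<sigma> \<subseteq> G"
      using assms(1) by blast
    with v(2) show "\<sigma> \<in> generated_complex {F} \<inter> generated_complex \<G>"
      by (auto simp: generated_complex_def)
  qed
qed

text \<open>Every face lies in some \<open>F - {v}\<close>, so a facet equals it and has one vertex
  less than \<open>F\<close>. Nonemptiness of \<open>A\<close> supplies a face, as
  \<open>pure_of_dim\<close> demands.\<close>

lemma pure_generated_complex_Diff:
  assumes "finite F" "A \<subseteq> F" "A \<noteq> {}"
  shows "pure_of_dim (generated_complex {F - {v} | v. v \<in> A}) (int (card F) - 2)"
proof -
  let ?C = "generated_complex {F - {v} | v. v \<in> A}"
  have "\<Union>?C \<subseteq> F"
    by (auto simp: generated_complex_def)
  then have "finite (\<Union>?C)"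
    using assms(1) by (rule finite_subset)
  then have "simplicial_complex ?C"
    by (auto simp: simplicial_complex_def generated_complex_def)
  moreover have "?C \<noteq> {}"
    using assms(3) by (auto simp: generated_complex_def)
  moreover have "int (card \<sigma>) - 1 = int (card F) - 2" if "\<sigma> \<in> facets ?C" for \<sigma>
  proof -
    have "\<sigma> \<in> ?C"
      using that by (simp add: facets_def)
    then obtain v where v: "v \<in> A" "\<sigma> \<subseteq> F - {v}"
      unfolding generated_complex_def by blast
    then have "F - {v} \<in> ?C"
      by (auto simp: generated_complex_def)
    with that v(2) have "\<sigma> = F - {v}"
      by (auto simp: facets_def)
    moreover have "v \<in> F"
      using v(1) assms(2) by blast
    then have "card F > 0"
      using assms(1) card_gt_0_iff by blast
    ultimately show ?thesis
      using \<open>v \<in> F\<close> assms(1) by (simp add: card_Diff_singleton)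
  qed
  ultimately show ?thesis
    by (simp add: pure_of_dim_def)
qed

lemma intersection_with_earlier:
  assumes "facet m n F"
  shows "generated_complex {F} \<inter> generated_complex {G. facet m n G \<and> facet_less G F}
    = generated_complex {F - {v} | v. v \<in> F_minus F}"
  using facet.F_minus_exchange[OF assms] facet.F_minus_separates[OF assms]
  by (intro intersection_generated_complex) auto

lemma intersection_with_later:
  assumes "facet m n F"
  shows "generated_complex {F} \<inter> generated_complex {G. facet m n G \<and> facet_less F G}
    = generated_complex {F - {v} | v. v \<in> F_plus m F}"
  using facet.F_plus_exchange[OF assms] facet.F_plus_separates[OF assms]
  by (intro intersection_generated_complex) auto

lemma facet_less_asym:
  assumes "facet m n F" "facet m n G" "facet_less F G"
  shows "\<not> facet_less G F"
  using facet_less_trans[OF assms(1,2,1,3)] facet_less_irrefl[OF assms(1)] by blast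

lemma no_earlier_facet:
  assumes "facet m n F" "\<forall>G\<in>{G. facet m n G}. G \<noteq> F \<longrightarrow> facet_less F G"
  shows "{G. facet m n G \<and> facet_less G F} = {}"
proof -
  have "\<not> facet_less G F" if "facet m n G" for G
    using assms that facet_less_asym[of m n F G] facet_less_irrefl[of m n F]
    by (cases "G = F") simp_all
  then show ?thesis
    by simp
qed

lemma no_later_facet:
  assumes "facet m n F" "\<forall>G\<in>{G. facet m n G}. G \<noteq> F \<longrightarrow> facet_less G F"
  shows "{G. facet m n G \<and> facet_less F G} = {}"
proof -
  have "\<not> facet_less F G" if "facet m n G" for G
    using assms that facet_less_asym[of m n G F] facet_less_irrefl[of m n F]
    by (cases "G = F") simp_all
  then show ?thesis
    by simp
qed

lemma card_facet: "facet m n F \<Longrightarrow> int (card F) - 1 = int n - 2"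
  using facet.card_eq facet.two_le_m facet.m_less_n by fastforce

lemma pure_faces:
  assumes "2 \<le> m" "m < n"
  shows "pure_of_dim {\<sigma>. is_face m n \<sigma>} (int n - 2)"
proof -
  let ?D = "{\<sigma>. is_face m n \<sigma>}"
  have "\<Union>?D \<subseteq> grid m n"
    by (auto simp: is_face_def)
  then have "finite (\<Union>?D)"
    by (rule finite_subset) simp
  then have "simplicial_complex ?D"
    using is_face_subset by (auto simp: simplicial_complex_def)
  moreover have "{} \<in> ?D"
    by (simp add: is_face_def rows_def southeast_chain_def)
  moreover have "int (card F) - 1 = int n - 2" if "F \<in> facets ?D" for F
    using that card_facet facet_iff[OF assms] by blast
  ultimately show ?thesis
    by (auto simp: pure_of_dim_def)
qed

lemma strict_linear_order_facets:
  "strict_linear_order_on {F. facet m n F} {(F, G). facet m n F \<and> facet m n G \<and> facet_less F G}"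
  unfolding strict_linear_order_on_def
proof (intro conjI)
  show "trans {(F, G). facet m n F \<and> facet m n G \<and> facet_less F G}"
    using facet_less_trans unfolding trans_def by blast
  show "irrefl {(F, G). facet m n F \<and> facet m n G \<and> facet_less F G}"
    using facet_less_irrefl unfolding irrefl_def by blast
  show "total_on {F. facet m n F} {(F, G). facet m n F \<and> facet m n G \<and> facet_less F G}"
    unfolding total_on_def
  proof (intro ballI impI)
    fix F G assume "F \<in> {F. facet m n F}" "G \<in> {F. facet m n F}" "F \<noteq> G"
    then show "(F, G) \<in> {(F, G). facet m n F \<and> facet m n G \<and> facet_less F G} \<or>
        (G, F) \<in> {(F, G). facet m n F \<and> facet m n G \<and> facet_less F G}"
      using facet_less_linear[of m n F G] by simp
  qed
qed

lemma pure_intersection_with_earlier: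
  assumes "facet m n F" "facet m n G" "facet_less G F"
  shows "pure_of_dim (generated_complex {F} \<inter> generated_complex {G. facet m n G \<and> facet_less G F})
    (int n - 2 - 1)"
proof -
  \<comment> \<open>The earlier facet \<open>G\<close> misses a vertex of
    \<open>F_minus F\<close>.\<close>
  have "F_minus F \<noteq> {}"
    using facet.F_minus_separates[OF assms] by blast
  then have "pure_of_dim (generated_complex {F - {v} | v. v \<in> F_minus F}) (int (card F) - 2)"
    by (intro pure_generated_complex_Diff facet.finite_F[OF assms(1)]) (auto simp: F_minus_def)
  moreover have "int (card F) - 2 = int n - 2 - 1"
    using card_facet[OF assms(1)] by simp
  ultimately show ?thesis
    by (simp only: intersection_with_earlier[OF assms(1)])
qed

lemma pure_intersection_with_later:
  assumes "facet m n F" "facet m n G" "facet_less F G"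
  shows "pure_of_dim (generated_complex {F} \<inter> generated_complex {G. facet m n G \<and> facet_less F G})
    (int n - 2 - 1)"
proof -
  have "F_plus m F \<noteq> {}"
    using facet.F_plus_separates[OF assms] by blast
  then have "pure_of_dim (generated_complex {F - {v} | v. v \<in> F_plus m F}) (int (card F) - 2)"
    by (intro pure_generated_complex_Diff facet.finite_F[OF assms(1)]) (auto simp: F_plus_def)
  moreover have "int (card F) - 2 = int n - 2 - 1"
    using card_facet[OF assms(1)] by simp
  ultimately show ?thesis
    by (simp only: intersection_with_later[OF assms(1)])
qed

lemma two_way_shelling_faces:
  assumes "2 \<le> m" "m < n"
  shows "two_way_shelling (int n - 2) {\<sigma>. is_face m n \<sigma>}
    {(F, G). facet m n F \<and> facet m n G \<and> facet_less F G}"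
proof -
  let ?D = "{\<sigma>. is_face m n \<sigma>}" and ?r = "{(F, G). facet m n F \<and> facet m n G \<and> facet_less F G}"
  have facets: "facets ?D = {F. facet m n F}"
    using facet_iff[OF assms] by blast
  have linear': "strict_linear_order_on {F. facet m n F} (?r\<inverse>)"
    using strict_linear_order_facets[of m n] unfolding strict_linear_order_on_def by simp
  have "pure_of_dim (generated_complex {F} \<inter> generated_complex {G. (G, F) \<in> ?r}) (int n - 2 - 1)"
    if "facet m n F" "\<exists>G. (G, F) \<in> ?r" for F
    using that pure_intersection_with_earlier[of m n F] by auto
  then have "shelling_order (int n - 2) ?D ?r"
    unfolding shelling_order_def facets
    using pure_faces[OF assms] strict_linear_order_facets[of m n] by auto
  moreover
  have "pure_of_dim (generated_complex {F} \<inter> generated_complex {G. (G, F) \<in> ?r\<inverse>}) (int n - 2 - 1)"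
    if "facet m n F" "\<exists>G. (G, F) \<in> ?r\<inverse>" for F
    using that pure_intersection_with_later[of m n F] by auto
  then have "shelling_order (int n - 2) ?D (?r\<inverse>)"
    unfolding shelling_order_def facets using pure_faces[OF assms] linear' by auto
  ultimately show ?thesis
    by (simp add: two_way_shelling_def)
qed

theorem theorem4p4:
  fixes m n :: nat
    and D :: "(nat \<times> nat) set set"
  assumes "2 \<le> m" and "m < n"
    and D: "D = Delta TYPE('k::field) m n"
  shows
    "(\<forall>F\<in>facets D.
        generated_complex {F} \<inter> generated_complex {G \<in> facets D. facet_less G F}
          = generated_complex {F - {v} | v. v \<in> F_minus F} \<and>
        generated_complex {F} \<inter> generated_complex {G \<in> facets D. facet_less F G}
          = generated_complex {F - {v} | v. v \<in> F_plus m F} \<and>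
        ((\<forall>G\<in>facets D. G \<noteq> F \<longrightarrow> facet_less F G) \<longrightarrow>
          generated_complex {F} \<inter> generated_complex {G \<in> facets D. facet_less G F} = {} \<and>
          generated_complex {F - {v} | v. v \<in> F_minus F} = {}) \<and>
        ((\<forall>G\<in>facets D. G \<noteq> F \<longrightarrow> facet_less G F) \<longrightarrow>
          generated_complex {F} \<inter> generated_complex {G \<in> facets D. facet_less F G} = {} \<and>
          generated_complex {F - {v} | v. v \<in> F_plus m F} = {})) \<and>
     two_way_shelling (int n - 2) D
       {(F, G). F \<in> facets D \<and> G \<in> facets D \<and> facet_less F G}"
proof -
  have facets: "facets D = {F. facet m n F}"
    using facet_iff[OF assms(1,2)] by (auto simp: D Delta_eq)
  have empty: "generated_complex {} = {}"
    by (simp add: generated_complex_def)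
  have parts: "generated_complex {F} \<inter> generated_complex {G. facet m n G \<and> facet_less G F}
        = generated_complex {F - {v} | v. v \<in> F_minus F} \<and>
      generated_complex {F} \<inter> generated_complex {G. facet m n G \<and> facet_less F G}
        = generated_complex {F - {v} | v. v \<in> F_plus m F} \<and>
      ((\<forall>G\<in>{G. facet m n G}. G \<noteq> F \<longrightarrow> facet_less F G) \<longrightarrow>
        generated_complex {F} \<inter> generated_complex {G. facet m n G \<and> facet_less G F} = {} \<and>
        generated_complex {F - {v} | v. v \<in> F_minus F} = {}) \<and>
      ((\<forall>G\<in>{G. facet m n G}. G \<noteq> F \<longrightarrow> facet_less G F) \<longrightarrow>
        generated_complex {F} \<inter> generated_complex {G. facet m n G \<and> facet_less F G} = {} \<and>
        generated_complex {F - {v} | v. v \<in> F_plus m F} = {})"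
    if "F \<in> {F. facet m n F}" for F
  proof -
    have F: "facet m n F"
      using that by simp
    show ?thesis
      \<comment> \<open>Written as intersections, the complexes on the right make the two equations
        reflexive; for an extreme facet both empty complexes become intersections with the complex
        without generators.\<close>
      unfolding intersection_with_earlier[OF F, symmetric] intersection_with_later[OF F, symmetric]
      by (intro conjI refl impI;
          simp only: no_earlier_facet[OF F] no_later_facet[OF F] empty Int_empty_right)
  qed
  show ?thesis
    unfolding facets mem_Collect_eq[of _ "\<lambda>F. facet m n F"]
    using parts two_way_shelling_faces[OF assms(1,2)] unfolding D Delta_eq by simp
qed

end
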